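(* Let $\kappa$ be a cardinal and $\theta<\kappa$ a regular cardinal, and assume $\mathsf{CP}(\kappa^+,\theta)$. Let $W$ be an inner model such that $\kappa$ is a regular cardinal of $W$ and $(\kappa^+)^W=\kappa^+$. Then $\mathrm{cof}(\kappa)\neq\theta$ (in $V$).
   Context: For regular cardinals $\theta<\mu$, a $\theta$-covering matrix for $\mu$ is a family $\mathcal D=(K(\alpha,\beta):\alpha<\theta,\ \beta<\mu)$ of subsets of $\mu$ such that: (i) $\beta\subseteq\bigcup_{\alpha<\theta}K(\alpha,\beta)$; (ii) $|K(\alpha,\beta)|<\mu$; (iii) $K(\alpha,\beta)\subseteq K(\eta,\beta)$ for $\alpha<\eta<\theta$; (iv) for all $\gamma<\beta<\mu$ and $\alpha<\theta$ there is $\eta<\theta$ with $K(\alpha,\gamma)\subseteq K(\eta,\beta)$; (v) for every $X\subseteq\mu$ with $|X|\leq\theta$ there is $\gamma_X<\mu$ such that for all $\beta<\mu$, $\eta<\theta$ there is $\alpha<\theta$ with $K(\eta,\beta)\cap X\subseteq K(\alpha,\gamma_X)$. $\mathsf{CP}(\mu,\theta)$: for every $\theta$-covering matrix $\mathcal D$ for $\mu$ there is an unbounded $A\subseteq\mu$ such that every subset of $A$ of size $\theta$ is contained in some $K(\alpha,\beta)$. *)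

theory Defs
  imports Main
begin

text \<open>
  Set theory is treated semantically: a universe of sets is a type \<open>'v\<close> with a membership
  relation \<open>E\<close> satisfying first-order ZFC, so a statement about all such universes is a theorem
  of ZFC. Every notion is relativised to a class \<open>M\<close> of sets: \<open>M = UNIV\<close> gives the notion of
  the universe, and \<open>M = W\<close> gives its relativisation to an inner model \<open>W\<close>.
\<close>

datatype fm = Mem nat nat | Eq nat nat | Neg fm | Conj fm fm | Ex nat fm

primrec sat :: "'v set \<Rightarrow> ('v \<Rightarrow> 'v \<Rightarrow> bool) \<Rightarrow> (nat \<Rightarrow> 'v) \<Rightarrow> fm \<Rightarrow> bool" where
  "sat M E s (Mem i j) \<longleftrightarrow> E (s i) (s j)"
| "sat M E s (Eq i j) \<longleftrightarrow> s i = s j"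
| "sat M E s (Neg \<phi>) \<longleftrightarrow> \<not> sat M E s \<phi>"
| "sat M E s (Conj \<phi> \<psi>) \<longleftrightarrow> sat M E s \<phi> \<and> sat M E s \<psi>"
| "sat M E s (Ex i \<phi>) \<longleftrightarrow> (\<exists>x\<in>M. sat M E (s(i := x)) \<phi>)"

context
  fixes M :: "'v set" and E :: "'v \<Rightarrow> 'v \<Rightarrow> bool"
begin

definition elts :: "'v \<Rightarrow> 'v set" where
  "elts x = {y \<in> M. E y x}"

subsection \<open>The axioms of ZFC\<close>

definition ax_extensionality :: bool where
  "ax_extensionality \<longleftrightarrow> (\<forall>x\<in>M. \<forall>y\<in>M. elts x = elts y \<longrightarrow> x = y)"

definition ax_foundation :: bool where
  "ax_foundation \<longleftrightarrow> (\<forall>x\<in>M. elts x \<noteq> {} \<longrightarrow> (\<exists>y\<in>elts x. elts y \<inter> elts x = {}))"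

definition ax_pairing :: bool where
  "ax_pairing \<longleftrightarrow> (\<forall>x\<in>M. \<forall>y\<in>M. \<exists>z\<in>M. elts z = {x, y})"

definition ax_union :: bool where
  "ax_union \<longleftrightarrow> (\<forall>x\<in>M. \<exists>u\<in>M. elts u = (\<Union>y\<in>elts x. elts y))"

definition ax_power_set :: bool where
  "ax_power_set \<longleftrightarrow> (\<forall>x\<in>M. \<exists>p\<in>M. elts p = {z \<in> M. elts z \<subseteq> elts x})"

definition ax_infinity :: bool where
  "ax_infinity \<longleftrightarrow>
     (\<exists>u\<in>M. (\<exists>e\<in>elts u. elts e = {}) \<and>
            (\<forall>x\<in>elts u. \<exists>y\<in>elts u. elts y = insert x (elts x)))"

text \<open>In the schemes, \<open>s\<close> supplies the parameters of \<open>\<phi>\<close>.\<close>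

definition ax_separation :: bool where
  "ax_separation \<longleftrightarrow>
     (\<forall>\<phi> s. range s \<subseteq> M \<longrightarrow>
        (\<forall>a\<in>M. \<exists>b\<in>M. elts b = {x \<in> elts a. sat M E (s(0 := x)) \<phi>}))"

definition ax_replacement :: bool where
  "ax_replacement \<longleftrightarrow>
     (\<forall>\<phi> s. range s \<subseteq> M \<longrightarrow>
        (\<forall>a\<in>M. (\<forall>x\<in>elts a. \<exists>!y. y \<in> M \<and> sat M E (s(0 := x, 1 := y)) \<phi>) \<longrightarrow>
           (\<exists>b\<in>M. elts b = {y \<in> M. \<exists>x\<in>elts a. sat M E (s(0 := x, 1 := y)) \<phi>})))"

definition ax_choice :: bool where
  "ax_choice \<longleftrightarrow>
     (\<forall>x\<in>M. (\<forall>y\<in>elts x. elts y \<noteq> {}) \<and>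
            (\<forall>y\<in>elts x. \<forall>z\<in>elts x. y \<noteq> z \<longrightarrow> elts y \<inter> elts z = {}) \<longrightarrow>
        (\<exists>c\<in>M. \<forall>y\<in>elts x. \<exists>!z. z \<in> elts y \<inter> elts c))"

definition ZFC_model :: bool where
  "ZFC_model \<longleftrightarrow>
     ax_extensionality \<and> ax_foundation \<and> ax_pairing \<and> ax_union \<and> ax_power_set \<and>
     ax_infinity \<and> ax_separation \<and> ax_replacement \<and> ax_choice"

subsection \<open>Pairs and functions\<close>

text \<open>Kuratowski pairs: \<open>p = {{x}, {x, y}}\<close>.\<close>

definition is_opair :: "'v \<Rightarrow> 'v \<Rightarrow> 'v \<Rightarrow> bool" where
  "is_opair p x y \<longleftrightarrow> (\<exists>a\<in>M. \<exists>b\<in>M. elts a = {x} \<and> elts b = {x, y} \<and> elts p = {a, b})"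

definition maps_to :: "'v \<Rightarrow> 'v \<Rightarrow> 'v \<Rightarrow> bool" where
  "maps_to f x y \<longleftrightarrow> (\<exists>p\<in>elts f. is_opair p x y)"

definition is_function :: "'v \<Rightarrow> 'v \<Rightarrow> 'v \<Rightarrow> bool" where
  "is_function f A B \<longleftrightarrow>
     f \<in> M \<and> (\<forall>p\<in>elts f. \<exists>x\<in>elts A. \<exists>y\<in>elts B. is_opair p x y) \<and>
     (\<forall>x\<in>elts A. \<exists>!y. y \<in> elts B \<and> maps_to f x y)"

definition is_bijection :: "'v \<Rightarrow> 'v \<Rightarrow> 'v \<Rightarrow> bool" where
  "is_bijection f A B \<longleftrightarrow>
     is_function f A B \<and> (\<forall>y\<in>elts B. \<exists>!x. x \<in> elts A \<and> maps_to f x y)"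

subsection \<open>Ordinals and cardinals\<close>

definition is_ordinal :: "'v \<Rightarrow> bool" where
  "is_ordinal x \<longleftrightarrow>
     x \<in> M \<and>
     (\<forall>y\<in>elts x. elts y \<subseteq> elts x) \<and>
     (\<forall>y\<in>elts x. \<not> E y y) \<and>
     (\<forall>y\<in>elts x. \<forall>z\<in>elts x. \<forall>w\<in>elts x. E y z \<longrightarrow> E z w \<longrightarrow> E y w) \<and>
     (\<forall>y\<in>elts x. \<forall>z\<in>elts x. E y z \<or> y = z \<or> E z y) \<and>
     (\<forall>z\<in>M. elts z \<subseteq> elts x \<and> elts z \<noteq> {} \<longrightarrow> (\<exists>y\<in>elts z. \<forall>w\<in>elts z. y = w \<or> E y w))"

definition is_limit :: "'v \<Rightarrow> bool" where
  "is_limit x \<longleftrightarrow> is_ordinal x \<and> elts x \<noteq> {} \<and> (\<forall>y\<in>elts x. \<exists>z\<in>elts x. E y z)"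

definition is_omega :: "'v \<Rightarrow> bool" where
  "is_omega x \<longleftrightarrow> is_limit x \<and> (\<forall>y\<in>elts x. \<not> is_limit y)"

definition is_cardinal :: "'v \<Rightarrow> bool" where
  "is_cardinal x \<longleftrightarrow> is_ordinal x \<and> (\<forall>y\<in>elts x. \<not> (\<exists>f\<in>M. is_bijection f x y))"

definition is_infinite_cardinal :: "'v \<Rightarrow> bool" where
  "is_infinite_cardinal x \<longleftrightarrow> is_cardinal x \<and> (\<exists>w\<in>M. is_omega w \<and> (w = x \<or> E w x))"

text \<open>\<open>c\<close> is the cardinality of \<open>x\<close>.\<close>

definition is_card_of :: "'v \<Rightarrow> 'v \<Rightarrow> bool" where
  "is_card_of x c \<longleftrightarrow> is_cardinal c \<and> (\<exists>f\<in>M. is_bijection f x c)"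

definition card_less :: "'v \<Rightarrow> 'v \<Rightarrow> bool" where
  "card_less x k \<longleftrightarrow> (\<exists>c\<in>M. is_card_of x c \<and> E c k)"

definition card_le :: "'v \<Rightarrow> 'v \<Rightarrow> bool" where
  "card_le x k \<longleftrightarrow> (\<exists>c\<in>M. is_card_of x c \<and> (c = k \<or> E c k))"

text \<open>\<open>l\<close> is the cardinal successor of \<open>k\<close>.\<close>

definition is_succ_cardinal :: "'v \<Rightarrow> 'v \<Rightarrow> bool" where
  "is_succ_cardinal k l \<longleftrightarrow>
     is_cardinal l \<and> E k l \<and> (\<forall>m\<in>M. is_cardinal m \<and> E k m \<longrightarrow> l = m \<or> E l m)"

definition has_cofinal_map :: "'v \<Rightarrow> 'v \<Rightarrow> bool" where
  "has_cofinal_map d k \<longleftrightarrow>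
     (\<exists>f\<in>M. is_function f d k \<and>
        (\<forall>x\<in>elts k. \<exists>i\<in>elts d. \<exists>y\<in>elts k. maps_to f i y \<and> (x = y \<or> E x y)))"

text \<open>\<open>d\<close> is the cofinality of the ordinal \<open>k\<close>.\<close>

definition is_cof :: "'v \<Rightarrow> 'v \<Rightarrow> bool" where
  "is_cof k d \<longleftrightarrow>
     is_ordinal d \<and> has_cofinal_map d k \<and> (\<forall>e\<in>elts d. \<not> has_cofinal_map e k)"

definition is_regular_cardinal :: "'v \<Rightarrow> bool" where
  "is_regular_cardinal k \<longleftrightarrow> is_infinite_cardinal k \<and> is_cof k k"

subsection \<open>Covering matrices\<close>

text \<open>A matrix is a set of the universe: a function with domain \<open>\<theta> \<times> \<mu>\<close>.\<close>

definition is_entry :: "'v \<Rightarrow> 'v \<Rightarrow> 'v \<Rightarrow> 'v \<Rightarrow> bool" where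
  "is_entry D \<alpha> \<beta> k \<longleftrightarrow> k \<in> M \<and> (\<exists>q\<in>M. is_opair q \<alpha> \<beta> \<and> maps_to D q k)"

definition is_matrix :: "'v \<Rightarrow> 'v \<Rightarrow> 'v \<Rightarrow> bool" where
  "is_matrix D \<theta> \<mu> \<longleftrightarrow>
     D \<in> M \<and>
     (\<forall>p\<in>elts D. \<exists>\<alpha>\<in>elts \<theta>. \<exists>\<beta>\<in>elts \<mu>. \<exists>q\<in>M. \<exists>k\<in>M. is_opair q \<alpha> \<beta> \<and> is_opair p q k) \<and>
     (\<forall>\<alpha>\<in>elts \<theta>. \<forall>\<beta>\<in>elts \<mu>. \<exists>!k. is_entry D \<alpha> \<beta> k)"

definition entry :: "'v \<Rightarrow> 'v \<Rightarrow> 'v \<Rightarrow> 'v" where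
  "entry D \<alpha> \<beta> = (THE k. is_entry D \<alpha> \<beta> k)"

definition is_covering_matrix :: "'v \<Rightarrow> 'v \<Rightarrow> 'v \<Rightarrow> bool" where
  "is_covering_matrix D \<theta> \<mu> \<longleftrightarrow>
     is_matrix D \<theta> \<mu> \<and>
     (\<forall>\<alpha>\<in>elts \<theta>. \<forall>\<beta>\<in>elts \<mu>. elts (entry D \<alpha> \<beta>) \<subseteq> elts \<mu>) \<and>
     (\<forall>\<beta>\<in>elts \<mu>. elts \<beta> \<subseteq> (\<Union>\<alpha>\<in>elts \<theta>. elts (entry D \<alpha> \<beta>))) \<and>
     (\<forall>\<alpha>\<in>elts \<theta>. \<forall>\<beta>\<in>elts \<mu>. card_less (entry D \<alpha> \<beta>) \<mu>) \<and>
     (\<forall>\<alpha>\<in>elts \<theta>. \<forall>\<eta>\<in>elts \<theta>. \<forall>\<beta>\<in>elts \<mu>. E \<alpha> \<eta> \<longrightarrow>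
        elts (entry D \<alpha> \<beta>) \<subseteq> elts (entry D \<eta> \<beta>)) \<and>
     (\<forall>\<gamma>\<in>elts \<mu>. \<forall>\<beta>\<in>elts \<mu>. \<forall>\<alpha>\<in>elts \<theta>. E \<gamma> \<beta> \<longrightarrow>
        (\<exists>\<eta>\<in>elts \<theta>. elts (entry D \<alpha> \<gamma>) \<subseteq> elts (entry D \<eta> \<beta>))) \<and>
     (\<forall>X\<in>M. elts X \<subseteq> elts \<mu> \<and> card_le X \<theta> \<longrightarrow>
        (\<exists>\<gamma>\<in>elts \<mu>. \<forall>\<beta>\<in>elts \<mu>. \<forall>\<eta>\<in>elts \<theta>. \<exists>\<alpha>\<in>elts \<theta>.
           elts (entry D \<eta> \<beta>) \<inter> elts X \<subseteq> elts (entry D \<alpha> \<gamma>)))"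

definition CP :: "'v \<Rightarrow> 'v \<Rightarrow> bool" where
  "CP \<mu> \<theta> \<longleftrightarrow>
     (\<forall>D\<in>M. is_covering_matrix D \<theta> \<mu> \<longrightarrow>
        (\<exists>A\<in>M. elts A \<subseteq> elts \<mu> \<and> (\<forall>\<xi>\<in>elts \<mu>. \<exists>a\<in>elts A. E \<xi> a) \<and>
           (\<forall>X\<in>M. elts X \<subseteq> elts A \<and> is_card_of X \<theta> \<longrightarrow>
              (\<exists>\<alpha>\<in>elts \<theta>. \<exists>\<beta>\<in>elts \<mu>. elts X \<subseteq> elts (entry D \<alpha> \<beta>)))))"

end

subsection \<open>Inner models\<close>

text \<open>Classes are definable with parameters, as usual in ZFC.\<close>

definition definable_class :: "('v \<Rightarrow> 'v \<Rightarrow> bool) \<Rightarrow> 'v set \<Rightarrow> bool" where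
  "definable_class E W \<longleftrightarrow> (\<exists>\<phi> s. W = {x. sat UNIV E (s(0 := x)) \<phi>})"

definition inner_model :: "('v \<Rightarrow> 'v \<Rightarrow> bool) \<Rightarrow> 'v set \<Rightarrow> bool" where
  "inner_model E W \<longleftrightarrow>
     definable_class E W \<and>
     (\<forall>x\<in>W. \<forall>y. E y x \<longrightarrow> y \<in> W) \<and>
     (\<forall>x. is_ordinal UNIV E x \<longrightarrow> x \<in> W) \<and>
     ZFC_model W E"

end

theory Submission
  imports Defs
begin

text \<open>
  Suppose that \<open>k\<close> has cofinality \<open>\<theta>\<close> in the universe, with witness \<open>g\<close>, and let \<open>l\<close> be its
  successor. Choose injections \<open>phi b : b \<rightarrow> k\<close> in \<open>W\<close> for \<open>b < l\<close> and put
  \<open>K a b = {x \<in> b. phi b x < G a}\<close>, where \<open>G a < k\<close> is the strict supremum of \<open>g\<close> on \<open>a\<close>. Since \<open>k\<close>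
  is regular in \<open>W\<close>, the map \<open>phi b \<circ> (phi b')\<inverse>\<close> is bounded on \<open>G a\<close>, so \<open>K a b' \<inter> b\<close> is contained in
  some \<open>K a' b\<close>; with the regularity of \<open>l\<close> this makes \<open>K\<close> a covering matrix. If \<open>A\<close> is unbounded in
  \<open>l\<close>, then some \<open>A \<inter> b\<close> is contained in no \<open>K a b\<close>, because \<open>K a b\<close> injects into \<open>G a\<close>. Points
  of \<open>A \<inter> b\<close> outside the \<open>\<theta>\<close> many sets \<open>K a b\<close> form a set of size \<open>\<theta>\<close> that, by coherence, no
  entry of the matrix covers.

  All constructions inside the model are separations from products and power sets. Hence the only
  metamathematical tool is a calculus of definability with parameters.
\<close>

section \<open>Definability with parameters\<close>

text \<open>The universe is an arbitrary model of ZFC and may be ill-founded from outside. So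
  recursions are replaced by the union of all partial solutions or by the intersection of all closed
  sets, and every new set needs a defining formula. The universe and the inner model are two
  instances of one development, with the same \<open>E\<close>. The two models share the work
  unevenly. Each single injection \<open>phi b\<close> lies in \<open>W\<close>, because
  \<open>l\<close> is the successor of \<open>k\<close> there, but the family of all of them is
  chosen in the universe and need not lie in \<open>W\<close>. Coherence compares only two columns
  at a time, so it can still be argued in \<open>W\<close>, where \<open>k\<close> is regular. The
  bound obtained there is then overtaken by the cofinal sequence, which exists only in the
  universe.\<close>

primrec rename_fm :: "(nat \<Rightarrow> nat) \<Rightarrow> fm \<Rightarrow> fm" where
  "rename_fm f (Mem i j) = Mem (f i) (f j)"
| "rename_fm f (Eq i j) = Eq (f i) (f j)"
| "rename_fm f (Neg \<phi>) = Neg (rename_fm f \<phi>)"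
| "rename_fm f (Conj \<phi> \<psi>) = Conj (rename_fm f \<phi>) (rename_fm f \<psi>)"
| "rename_fm f (Ex i \<phi>) = Ex (f i) (rename_fm f \<phi>)"

text \<open>Bound variables are renamed along with free ones. Injectivity of \<open>f\<close>
  ensures that an update at \<open>f i\<close> is seen through \<open>f\<close> at \<open>i\<close>
  alone.\<close>

lemma sat_rename:
  assumes "inj f"
  shows "sat M E s (rename_fm f \<phi>) = sat M E (s \<circ> f) \<phi>"
proof (induction \<phi> arbitrary: s)
  case (Ex i \<phi>)
  have "(s(f i := x)) \<circ> f = (s \<circ> f)(i := x)" for x
    using assms by (auto simp: fun_eq_iff inj_eq)
  then show ?case by (simp only: rename_fm.simps sat.simps Ex)
qed auto

text \<open>A formula mentions finitely many variables. This lets the infinite assignment in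
  \<open>definable_class\<close> be cut down to a finite list of parameters.\<close>

lemma sat_finite_support:
  "\<exists>N. \<forall>s s'. (\<forall>n<N. s n = s' n) \<longrightarrow> sat M E s \<phi> = sat M E s' \<phi>"
proof (induction \<phi>)
  case (Mem i j)
  show ?case by (rule exI[of _ "Suc (max i j)"]) (simp add: less_Suc_eq_le)
next
  case (Eq i j)
  show ?case by (rule exI[of _ "Suc (max i j)"]) (simp add: less_Suc_eq_le)
next
  case (Neg \<phi>)
  then show ?case by auto
next
  case (Conj \<phi> \<psi>)
  then obtain N1 N2 where
    "\<forall>s s'. (\<forall>n<N1. s n = s' n) \<longrightarrow> sat M E s \<phi> = sat M E s' \<phi>"
    "\<forall>s s'. (\<forall>n<N2. s n = s' n) \<longrightarrow> sat M E s \<psi> = sat M E s' \<psi>" by blast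
  then have "\<forall>s s'. (\<forall>n<max N1 N2. s n = s' n) \<longrightarrow>
      sat M E s (Conj \<phi> \<psi>) = sat M E s' (Conj \<phi> \<psi>)"
    by (metis less_max_iff_disj sat.simps(4))
  then show ?case by blast
next
  case (Ex i \<phi>)
  then obtain N where N: "\<forall>s s'. (\<forall>n<N. s n = s' n) \<longrightarrow> sat M E s \<phi> = sat M E s' \<phi>" by blast
  have "sat M E (s(i := x)) \<phi> = sat M E (s'(i := x)) \<phi>" if "\<forall>n<N. s n = s' n" for s s' x
    using that by (intro N[rule_format]) auto
  then show ?case by (intro exI[of _ N]) auto
qed

text \<open>Parameters precede the free variables, so two parameter lists can be concatenated and
  both formulas renamed into the joint environment.\<close>

definition env :: "'v list \<Rightarrow> (nat \<Rightarrow> 'v) \<Rightarrow> nat \<Rightarrow> 'v" where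
  "env ps s n = (if n < length ps then ps ! n else s (n - length ps))"

lemma env_append_left:
  "env (ps @ qs) s \<circ> (\<lambda>n. if n < length ps then n else n + length qs) = env ps s"
  by (auto simp: fun_eq_iff env_def nth_append)

lemma env_append_right: "env (ps @ qs) s \<circ> (\<lambda>n. n + length ps) = env qs s"
  by (auto simp: fun_eq_iff env_def nth_append)

text \<open>The dummy parameter \<open>d\<close> reserves a position between the parameters and the
  variables. A quantifier over that position then acts as one that pushes \<open>x\<close> in front
  of \<open>s\<close>.\<close>

lemma env_upd: "(env (ps @ [d]) s)(length ps := x) = env ps (case_nat x s)"
  by (auto simp: fun_eq_iff env_def nth_append Suc_diff_Suc split: nat.splits)
    (metis Suc_diff_Suc diff_Suc_Suc linorder_neqE_nat nat.inject)+

section \<open>Closure properties of definable predicates\<close>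

locale zfc =
  fixes M :: "'v set" and E :: "'v \<Rightarrow> 'v \<Rightarrow> bool"
  assumes zfc: "ZFC_model M E"
begin

abbreviation el :: "'v \<Rightarrow> 'v set" where "el \<equiv> elts M E"

lemma el_iff: "y \<in> el x \<longleftrightarrow> y \<in> M \<and> E y x"
  by (simp add: elts_def)

lemma el_M: "y \<in> el x \<Longrightarrow> y \<in> M"
  by (simp add: elts_def)

lemma ex_M: "\<exists>d. d \<in> M"
  using zfc unfolding ZFC_model_def ax_infinity_def by blast

text \<open>Variables are read off an environment by position, and a quantifier pushes a new value at
  position 0. Thus the closure rules below are higher-order patterns, and \<open>intro\<close> decides
  definability syntactically.\<close>

definition tm :: "((nat \<Rightarrow> 'v) \<Rightarrow> 'v) \<Rightarrow> bool" where
  "tm t \<longleftrightarrow> (\<exists>i. t = (\<lambda>s. s i)) \<or> (\<exists>c\<in>M. t = (\<lambda>s. c))"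

text \<open>Agreement is demanded only for assignments into \<open>M\<close>; there \<open>E\<close>
  and membership in \<open>el\<close> can be exchanged.\<close>

definition dfn :: "((nat \<Rightarrow> 'v) \<Rightarrow> bool) \<Rightarrow> bool" where
  "dfn P \<longleftrightarrow> (\<exists>\<phi> ps. set ps \<subseteq> M \<and> (\<forall>s. range s \<subseteq> M \<longrightarrow> P s = sat M E (env ps s) \<phi>))"

lemma tm_var: "tm (\<lambda>s. s i)"
  by (auto simp: tm_def)

lemma tm_const: "c \<in> M \<Longrightarrow> tm (\<lambda>s. c)"
  by (auto simp: tm_def)

lemma tm_shift: "tm t \<Longrightarrow> tm (\<lambda>s. t (\<lambda>n. s (Suc n)))"
  by (auto simp: tm_def)

lemma tm_in_M: "tm t \<Longrightarrow> range s \<subseteq> M \<Longrightarrow> t s \<in> M"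
  by (auto simp: tm_def)

lemma tm_env:
  assumes "tm t"
  obtains ps i where "set ps \<subseteq> M" "\<And>s. t s = env ps s i"
proof -
  from assms consider i where "t = (\<lambda>s. s i)" | c where "c \<in> M" "t = (\<lambda>s. c)"
    by (auto simp: tm_def)
  then show thesis
  proof cases
    case 1
    then show ?thesis using that[of "[]" i] by (simp add: env_def)
  next
    case 2
    then show ?thesis using that[of "[c]" 0] by (simp add: env_def)
  qed
qed

lemma two_tm_env:
  assumes "tm t" "tm u"
  obtains ps i j where "set ps \<subseteq> M" "\<And>s. t s = env ps s i" "\<And>s. u s = env ps s j"
proof -
  obtain ps i where 1: "set ps \<subseteq> M" "\<And>s. t s = env ps s i" using tm_env[OF assms(1)] by blast
  obtain qs j where 2: "set qs \<subseteq> M" "\<And>s. u s = env qs s j" using tm_env[OF assms(2)] by blast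
  show thesis
  proof (rule that[of "ps @ qs"])
    show "t s = env (ps @ qs) s (if i < length ps then i else i + length qs)" for s
      using fun_cong[OF env_append_left[of ps qs s], of i] 1(2) by (simp add: o_def)
    show "u s = env (ps @ qs) s (j + length ps)" for s
      using fun_cong[OF env_append_right[of ps qs s], of j] 2(2) by (simp add: o_def)
  qed (use 1 2 in auto)
qed

lemma dfn_cong:
  assumes "dfn P" "\<And>s. range s \<subseteq> M \<Longrightarrow> P s = Q s"
  shows "dfn Q"
  using assms by (auto simp: dfn_def)

lemma dfn_E:
  assumes "tm t" "tm u"
  shows "dfn (\<lambda>s. E (t s) (u s))"
proof -
  obtain ps i j where "set ps \<subseteq> M" "\<And>s. t s = env ps s i" "\<And>s. u s = env ps s j"
    using two_tm_env[OF assms] by blast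
  then show ?thesis unfolding dfn_def by (intro exI[of _ "Mem i j"] exI[of _ ps]) simp
qed

lemma dfn_eq:
  assumes "tm t" "tm u"
  shows "dfn (\<lambda>s. t s = u s)"
proof -
  obtain ps i j where "set ps \<subseteq> M" "\<And>s. t s = env ps s i" "\<And>s. u s = env ps s j"
    using two_tm_env[OF assms] by blast
  then show ?thesis unfolding dfn_def by (intro exI[of _ "Eq i j"] exI[of _ ps]) simp
qed

lemma dfn_not: "dfn P \<Longrightarrow> dfn (\<lambda>s. \<not> P s)"
  proof -
  assume "dfn P"
  then obtain \<phi> ps where "set ps \<subseteq> M" "\<forall>s. range s \<subseteq> M \<longrightarrow> P s = sat M E (env ps s) \<phi>"
    by (auto simp: dfn_def)
  then show "dfn (\<lambda>s. \<not> P s)" unfolding dfn_def by (intro exI[of _ "Neg \<phi>"] exI[of _ ps]) simp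
qed

lemma dfn_conj:
  assumes "dfn P" "dfn Q"
  shows "dfn (\<lambda>s. P s \<and> Q s)"
proof -
  obtain \<phi> ps where 1: "set ps \<subseteq> M" "\<And>s. range s \<subseteq> M \<Longrightarrow> P s = sat M E (env ps s) \<phi>"
    using assms(1) by (auto simp: dfn_def)
  obtain \<psi> qs where 2: "set qs \<subseteq> M" "\<And>s. range s \<subseteq> M \<Longrightarrow> Q s = sat M E (env qs s) \<psi>"
    using assms(2) by (auto simp: dfn_def)
  let ?f = "\<lambda>n. if n < length ps then n else n + length qs"
  let ?g = "\<lambda>n. n + length ps"
  have "inj ?f" "inj ?g" by (auto simp: inj_def)
  then have "P s \<and> Q s \<longleftrightarrow> sat M E (env (ps @ qs) s) (Conj (rename_fm ?f \<phi>) (rename_fm ?g \<psi>))"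
    if "range s \<subseteq> M" for s
    using that by (simp only: 1(2) 2(2) sat.simps sat_rename env_append_left env_append_right)
  then show ?thesis using 1(1) 2(1) unfolding dfn_def
    by (intro exI[of _ "Conj (rename_fm ?f \<phi>) (rename_fm ?g \<psi>)"] exI[of _ "ps @ qs"]) auto
qed

lemma dfn_bex_M:
  assumes "dfn (\<lambda>s. R (\<lambda>n. s (Suc n)) (s 0))"
  shows "dfn (\<lambda>s. \<exists>x\<in>M. R s x)"
proof -
  obtain \<phi> ps where 1: "set ps \<subseteq> M"
    "\<And>s. range s \<subseteq> M \<Longrightarrow> R (\<lambda>n. s (Suc n)) (s 0) = sat M E (env ps s) \<phi>"
    using assms by (auto simp: dfn_def)
  obtain d where d: "d \<in> M" using ex_M by blast
  have "(\<exists>x\<in>M. R s x) = sat M E (env (ps @ [d]) s) (Ex (length ps) \<phi>)" if "range s \<subseteq> M" for s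
  proof -
    have "R s x = sat M E (env ps (case_nat x s)) \<phi>" if "x \<in> M" for x
    proof -
      have "case_nat x s n \<in> M" for n
        using that \<open>range s \<subseteq> M\<close> by (cases n) auto
      then show ?thesis using 1(2)[of "case_nat x s"] by auto
    qed
    then show ?thesis by (auto simp: env_upd)
  qed
  then show ?thesis using 1(1) d unfolding dfn_def
    by (intro exI[of _ "Ex (length ps) \<phi>"] exI[of _ "ps @ [d]"]) auto
qed

lemma dfn_disj: "dfn P \<Longrightarrow> dfn Q \<Longrightarrow> dfn (\<lambda>s. P s \<or> Q s)"
  using dfn_not[OF dfn_conj[OF dfn_not[of P] dfn_not[of Q]]] by simp

lemma dfn_imp: "dfn P \<Longrightarrow> dfn Q \<Longrightarrow> dfn (\<lambda>s. P s \<longrightarrow> Q s)"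
  using dfn_disj[OF dfn_not[of P], of Q] by simp

lemma dfn_iff: "dfn P \<Longrightarrow> dfn Q \<Longrightarrow> dfn (\<lambda>s. P s \<longleftrightarrow> Q s)"
  using dfn_conj[OF dfn_imp[of P Q] dfn_imp[of Q P]] by (simp add: iff_conv_conj_imp)

text \<open>\<open>A\<close> is a class of the model: this covers \<open>M\<close> itself, sets and inner models.\<close>

definition cls :: "'v set \<Rightarrow> bool" where
  "cls A \<longleftrightarrow> A \<subseteq> M \<and> dfn (\<lambda>s. s 0 \<in> A)"

text \<open>The value of the term is named by an existential quantifier, which takes the place of
  substitution inside formulas; \<open>tm_in_M\<close> supplies the witness.\<close>

lemma dfn_subst1:
  assumes "dfn (\<lambda>s. P (s 0))" "tm t"
  shows "dfn (\<lambda>s. P (t s))"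
proof (rule dfn_cong)
  show "dfn (\<lambda>s. \<exists>x\<in>M. x = t s \<and> P x)"
    by (intro dfn_bex_M dfn_conj dfn_eq tm_var tm_shift assms)
qed (use tm_in_M[OF assms(2)] in auto)

lemma dfn_mem_cls: "cls A \<Longrightarrow> tm t \<Longrightarrow> dfn (\<lambda>s. t s \<in> A)"
  using dfn_subst1[of "\<lambda>x. x \<in> A" t] by (simp add: cls_def)

lemma dfn_bex_cls:
  assumes "cls A" "dfn (\<lambda>s. R (\<lambda>n. s (Suc n)) (s 0))"
  shows "dfn (\<lambda>s. \<exists>x\<in>A. R s x)"
proof (rule dfn_cong)
  show "dfn (\<lambda>s. \<exists>x\<in>M. x \<in> A \<and> R s x)"
    by (intro dfn_bex_M dfn_conj dfn_mem_cls tm_var assms)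
qed (use assms(1) in \<open>auto simp: cls_def\<close>)

lemma dfn_ball_cls:
  assumes "cls A" "dfn (\<lambda>s. R (\<lambda>n. s (Suc n)) (s 0))"
  shows "dfn (\<lambda>s. \<forall>x\<in>A. R s x)"
  using dfn_not[OF dfn_bex_cls[OF assms(1), of "\<lambda>s x. \<not> R s x", OF dfn_not[OF assms(2)]]] by simp

lemma cls_M: "cls M"
proof -
  have "dfn (\<lambda>s. s 0 \<in> M)"
    by (rule dfn_cong[OF dfn_eq[OF tm_var[of 0] tm_var[of 0]]]) auto
  then show ?thesis by (simp add: cls_def)
qed

lemma dfn_mem_el:
  assumes "tm t" "tm u"
  shows "dfn (\<lambda>s. t s \<in> el (u s))"
  by (rule dfn_cong[OF dfn_E[OF assms]]) (use tm_in_M assms in \<open>auto simp: elts_def\<close>)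

lemma dfn_bex_el:
  assumes "tm t" "dfn (\<lambda>s. R (\<lambda>n. s (Suc n)) (s 0))"
  shows "dfn (\<lambda>s. \<exists>x\<in>el (t s). R s x)"
proof (rule dfn_cong)
  show "dfn (\<lambda>s. \<exists>x\<in>M. x \<in> el (t s) \<and> R s x)"
    by (intro dfn_bex_M dfn_conj dfn_mem_el tm_var tm_shift assms)
qed (auto simp: elts_def)

lemma dfn_ball_el:
  assumes "tm t" "dfn (\<lambda>s. R (\<lambda>n. s (Suc n)) (s 0))"
  shows "dfn (\<lambda>s. \<forall>x\<in>el (t s). R s x)"
  using dfn_not[OF dfn_bex_el[OF assms(1), of "\<lambda>s x. \<not> R s x", OF dfn_not[OF assms(2)]]] by simp

lemma dfn_subst2:
  assumes "dfn (\<lambda>s. P (s 0) (s 1))" "tm t" "tm u"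
  shows "dfn (\<lambda>s. P (t s) (u s))"
proof (rule dfn_cong)
  have *: "dfn (\<lambda>s. P (s 0) (s (Suc 0)))"
    using assms(1) by simp
  have "tm (\<lambda>s. u (\<lambda>n. s (Suc (Suc n))))" "tm (\<lambda>s. t (\<lambda>n. s (Suc (Suc n))))"
    using assms(2,3) by (auto simp: tm_def)
  then show "dfn (\<lambda>s. \<exists>y\<in>M. \<exists>x\<in>M. y = u s \<and> x = t s \<and> P x y)"
    by (intro dfn_bex_M dfn_conj dfn_eq tm_var *)
qed (use tm_in_M[OF assms(2)] tm_in_M[OF assms(3)] in auto)

lemma dfn_subst3:
  assumes "dfn (\<lambda>s. P (s 0) (s 1) (s 2))" "tm t" "tm u" "tm v"
  shows "dfn (\<lambda>s. P (t s) (u s) (v s))"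
proof (rule dfn_cong)
  have *: "dfn (\<lambda>s. P (s 0) (s (Suc 0)) (s (Suc (Suc 0))))"
    using assms(1) by (simp add: numeral_2_eq_2)
  have "tm (\<lambda>s. v (\<lambda>n. s (Suc (Suc (Suc n)))))"
    "tm (\<lambda>s. u (\<lambda>n. s (Suc (Suc (Suc n)))))"
    "tm (\<lambda>s. t (\<lambda>n. s (Suc (Suc (Suc n)))))"
    using assms(2-4) by (auto simp: tm_def)
  then show "dfn (\<lambda>s. \<exists>z\<in>M. \<exists>y\<in>M. \<exists>x\<in>M. z = v s \<and> y = u s \<and> x = t s \<and> P x y z)"
    by (intro dfn_bex_M dfn_conj dfn_eq tm_var *)
qed (use tm_in_M[OF assms(2)] tm_in_M[OF assms(3)] tm_in_M[OF assms(4)] in auto)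

lemmas dfn_basic = dfn_E dfn_eq dfn_not dfn_conj dfn_disj dfn_imp dfn_iff
  dfn_mem_el dfn_bex_el dfn_ball_el dfn_mem_cls dfn_bex_cls dfn_ball_cls
  tm_var tm_const cls_M

lemma el_eq_iff: "S \<subseteq> M \<Longrightarrow> el a = S \<longleftrightarrow> (\<forall>z\<in>M. z \<in> el a \<longleftrightarrow> z \<in> S)"
  using el_M by blast

lemma dfn_is_opair:
  assumes "tm t" "tm u" "tm v"
  shows "dfn (\<lambda>s. is_opair M E (t s) (u s) (v s))"
proof (rule dfn_subst3[OF _ assms])
  show "dfn (\<lambda>s. is_opair M E (s 0) (s 1) (s 2))"
  proof (rule dfn_cong)
    show "dfn (\<lambda>s. \<exists>a\<in>M. \<exists>b\<in>M. (\<forall>z\<in>M. z \<in> el a \<longleftrightarrow> z = s 1) \<and>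
        (\<forall>z\<in>M. z \<in> el b \<longleftrightarrow> z = s 1 \<or> z = s 2) \<and> (\<forall>z\<in>M. z \<in> el (s 0) \<longleftrightarrow> z = a \<or> z = b))"
      by (intro dfn_basic)
  next
    fix s :: "nat \<Rightarrow> 'v" assume "range s \<subseteq> M"
    then have s: "s 1 \<in> M" "s 2 \<in> M" by auto
    show "(\<exists>a\<in>M. \<exists>b\<in>M. (\<forall>z\<in>M. z \<in> el a \<longleftrightarrow> z = s 1) \<and>
        (\<forall>z\<in>M. z \<in> el b \<longleftrightarrow> z = s 1 \<or> z = s 2) \<and> (\<forall>z\<in>M. z \<in> el (s 0) \<longleftrightarrow> z = a \<or> z = b)) =
      is_opair M E (s 0) (s 1) (s 2)"
      unfolding is_opair_def
    proof (intro bex_cong refl)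
      fix a b assume "a \<in> M" "b \<in> M"
      with s show "((\<forall>z\<in>M. z \<in> el a \<longleftrightarrow> z = s 1) \<and> (\<forall>z\<in>M. z \<in> el b \<longleftrightarrow> z = s 1 \<or> z = s 2) \<and>
          (\<forall>z\<in>M. z \<in> el (s 0) \<longleftrightarrow> z = a \<or> z = b)) =
        (el a = {s 1} \<and> el b = {s 1, s 2} \<and> el (s 0) = {a, b})"
        using el_eq_iff[of "{s 1}" a] el_eq_iff[of "{s 1, s 2}" b] el_eq_iff[of "{a, b}" "s 0"]
        by simp
    qed
  qed
qed

lemma dfn_maps_to:
  assumes "tm t" "tm u" "tm v"
  shows "dfn (\<lambda>s. maps_to M E (t s) (u s) (v s))"
  unfolding maps_to_def
  by (rule dfn_subst3[OF _ assms]) (intro dfn_basic dfn_is_opair)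

end

lemma zfc_definable_class:
  assumes "zfc UNIV E" "definable_class E W"
  shows "zfc.cls UNIV E W"
proof -
  interpret zfc UNIV E by fact
  obtain \<phi> s where W: "W = {x. sat UNIV E (s(0 := x)) \<phi>}"
    using assms(2) by (auto simp: definable_class_def)
  obtain N where N: "\<forall>s s'. (\<forall>n<N. s n = s' n) \<longrightarrow> sat UNIV E s \<phi> = sat UNIV E s' \<phi>"
    using sat_finite_support by blast
  let ?ps = "map s [0..<N]" and ?f = "id(0 := N, N := 0)"
  have "inj ?f" by (auto simp: inj_def)
  then have "sat UNIV E (env ?ps t) (rename_fm ?f \<phi>) = sat UNIV E (env ?ps t \<circ> ?f) \<phi>" for t
    by (rule sat_rename)
  also have "sat UNIV E (env ?ps t \<circ> ?f) \<phi> = sat UNIV E (s(0 := t 0)) \<phi>" for t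
    by (intro N[rule_format]) (auto simp: env_def)
  finally have "(t 0 \<in> W) = sat UNIV E (env ?ps t) (rename_fm ?f \<phi>)" for t
    by (simp add: W)
  then show ?thesis unfolding cls_def dfn_def by blast
qed

section \<open>Sets and functions of the model seen from outside\<close>

context zfc
begin

text \<open>From here on a set of the model is handled through its extension, an ordinary HOL set.
  The HOL sets that arise in this way are the small ones, and \<open>st\<close> recovers the element
  from its extension.\<close>

definition small :: "'v set \<Rightarrow> bool" where
  "small S \<longleftrightarrow> (\<exists>a\<in>M. el a = S)"

definition st :: "'v set \<Rightarrow> 'v" where
  "st S = (SOME a. a \<in> M \<and> el a = S)"

lemma small_subset_M: "small S \<Longrightarrow> S \<subseteq> M"
  by (auto simp: small_def elts_def)

lemma small_el: "a \<in> M \<Longrightarrow> small (el a)"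
  by (auto simp: small_def)

lemma el_ext: "x \<in> M \<Longrightarrow> y \<in> M \<Longrightarrow> el x = el y \<Longrightarrow> x = y"
  using zfc unfolding ZFC_model_def ax_extensionality_def by blast

lemma st:
  assumes "small S"
  shows st_in_M: "st S \<in> M" and el_st: "el (st S) = S"
  using someI_ex[of "\<lambda>a. a \<in> M \<and> el a = S"] assms unfolding small_def st_def by auto

lemma st_el: "a \<in> M \<Longrightarrow> st (el a) = a"
  by (simp add: el_ext st small_el)

lemma small_sep:
  assumes "small S" and "dfn (\<lambda>s. P (s 0))"
  shows "small {x \<in> S. P x}"
proof -
  obtain a where a: "a \<in> M" "el a = S" using assms(1) by (auto simp: small_def)
  obtain \<phi> ps where ps: "set ps \<subseteq> M" "\<And>s. range s \<subseteq> M \<Longrightarrow> P (s 0) = sat M E (env ps s) \<phi>"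
    using assms(2) by (auto simp: dfn_def)
  let ?k = "length ps"
  \<comment> \<open>Separation expects the element at position 0, whereas \<open>env\<close> puts
    the parameters first. So the parameters move up by one, position \<open>length ps\<close> moves
    to 0, and the remaining positions are filled with \<open>a\<close>.\<close>
  let ?f = "\<lambda>n. if n < ?k then Suc n else if n = ?k then 0 else n"
  let ?t = "\<lambda>n. if 0 < n \<and> n \<le> ?k then ps ! (n - 1) else a"
  have inj: "inj ?f" by (auto simp: inj_def)
  have "P x = sat M E (?t(0 := x)) (rename_fm ?f \<phi>)" if "x \<in> S" for x
  proof -
    have "x \<in> M" using that a by (auto simp: elts_def)
    then have "P x = sat M E (env ps (\<lambda>n. if n = 0 then x else a)) \<phi>"
      using ps(2)[of "\<lambda>n. if n = 0 then x else a"] a by auto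
    also have "env ps (\<lambda>n. if n = 0 then x else a) = ?t(0 := x) \<circ> ?f"
      by (auto simp: fun_eq_iff env_def)
    finally show ?thesis by (simp only: sat_rename[OF inj])
  qed
  then have eq: "{x \<in> S. P x} = {x \<in> el a. sat M E (?t(0 := x)) (rename_fm ?f \<phi>)}"
    using a by auto
  have "ps ! (n - 1) \<in> M" if "0 < n" "n \<le> ?k" for n
    using ps(1) that by (auto intro: subsetD[OF _ nth_mem])
  then have "range ?t \<subseteq> M"
    using a by auto
  then show ?thesis
    using zfc a(1) unfolding ZFC_model_def ax_separation_def small_def eq by blast
qed

lemma cls_small: "small S \<Longrightarrow> cls S"
  unfolding small_def cls_def by (auto intro!: dfn_mem_el tm_var tm_const simp: el_M)

lemma small_subset_dfn: "small T \<Longrightarrow> S \<subseteq> T \<Longrightarrow> dfn (\<lambda>s. s 0 \<in> S) \<Longrightarrow> small S"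
  using small_sep[of T "\<lambda>x. x \<in> S"] by (simp add: Int_absorb1 Collect_conj_eq)

lemma small_Int: "small S \<Longrightarrow> small T \<Longrightarrow> small (S \<inter> T)"
  using small_sep[of S "\<lambda>x. x \<in> T"] dfn_mem_cls[OF cls_small tm_var] by (simp add: Int_def)

lemma small_Diff: "small S \<Longrightarrow> small T \<Longrightarrow> small (S - T)"
  using small_sep[of S "\<lambda>x. x \<notin> T"] dfn_not[OF dfn_mem_cls[OF cls_small tm_var]]
  by (simp add: set_diff_eq)

lemma small_pair: "x \<in> M \<Longrightarrow> y \<in> M \<Longrightarrow> small {x, y}"
  using zfc unfolding ZFC_model_def ax_pairing_def small_def by blast

lemma small_singleton: "x \<in> M \<Longrightarrow> small {x}"
  using small_pair[of x x] by simp

lemma small_Un: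
  assumes "small S" "small T"
  shows "small (S \<union> T)"
proof -
  have "el (st {st S, st T}) = {st S, st T}"
    using assms by (intro el_st small_pair st_in_M)
  then have "(\<Union>y\<in>el (st {st S, st T}). el y) = S \<union> T"
    using assms by (simp add: el_st)
  moreover have "st {st S, st T} \<in> M"
    using assms by (intro st_in_M small_pair)
  ultimately show ?thesis
    using zfc unfolding ZFC_model_def ax_union_def small_def by metis
qed

lemma small_Pow:
  assumes "small S"
  shows "small {z \<in> M. el z \<subseteq> S}"
  using zfc assms unfolding ZFC_model_def ax_power_set_def small_def by blast

subsection \<open>Pairs and relations\<close>

definition opr :: "'v \<Rightarrow> 'v \<Rightarrow> 'v" where
  "opr x y = st {st {x}, st {x, y}}"

lemma opr_in_M: "x \<in> M \<Longrightarrow> y \<in> M \<Longrightarrow> opr x y \<in> M"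
  unfolding opr_def by (intro st_in_M small_pair small_singleton)

lemma el_opr: "x \<in> M \<Longrightarrow> y \<in> M \<Longrightarrow> el (opr x y) = {st {x}, st {x, y}}"
  unfolding opr_def by (intro el_st st_in_M small_pair small_singleton)

lemma opr_inject:
  assumes "x \<in> M" "y \<in> M" "x' \<in> M" "y' \<in> M" "opr x y = opr x' y'"
  shows "x = x' \<and> y = y'"
proof -
  have e: "el (st {x}) = {x}" "el (st {x, y}) = {x, y}" "el (st {x'}) = {x'}" "el (st {x', y'}) = {x', y'}"
    using assms by (auto intro!: el_st small_pair small_singleton)
  have "{st {x}, st {x, y}} = {st {x'}, st {x', y'}}"
    using assms el_opr[of x y] el_opr[of x' y'] by simp
  then have "el ` {st {x}, st {x, y}} = el ` {st {x'}, st {x', y'}}"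
    by (rule arg_cong)
  then have "{{x}, {x, y}} = {{x'}, {x', y'}}"
    by (simp only: e image_insert image_empty)
  then show ?thesis by (auto simp: doubleton_eq_iff)
qed

lemma is_opair_iff: "p \<in> M \<Longrightarrow> is_opair M E p x y \<longleftrightarrow> x \<in> M \<and> y \<in> M \<and> p = opr x y"
proof
  assume p: "p \<in> M" and "is_opair M E p x y"
  then obtain a b where ab: "a \<in> M" "b \<in> M" "el a = {x}" "el b = {x, y}" "el p = {a, b}"
    by (auto simp: is_opair_def)
  then have xy: "x \<in> M" "y \<in> M" using el_M by blast+
  have "a = st {x}" "b = st {x, y}" using ab st_el by metis+
  then show "x \<in> M \<and> y \<in> M \<and> p = opr x y"
    using xy el_ext[OF p opr_in_M[OF xy]] el_opr[OF xy] ab by simp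
next
  assume "p \<in> M" and xy: "x \<in> M \<and> y \<in> M \<and> p = opr x y"
  then show "is_opair M E p x y"
    unfolding is_opair_def using el_opr[of x y] el_st[OF small_singleton, of x] el_st[OF small_pair, of x y]
      st_in_M[OF small_singleton, of x] st_in_M[OF small_pair, of x y] by metis
qed

lemma maps_to_iff: "maps_to M E f x y \<longleftrightarrow> x \<in> M \<and> y \<in> M \<and> opr x y \<in> el f"
proof
  assume "maps_to M E f x y"
  then obtain p where "p \<in> el f" "is_opair M E p x y" by (auto simp: maps_to_def)
  then show "x \<in> M \<and> y \<in> M \<and> opr x y \<in> el f" using is_opair_iff[OF el_M] by auto
next
  assume "x \<in> M \<and> y \<in> M \<and> opr x y \<in> el f"
  then show "maps_to M E f x y" unfolding maps_to_def using is_opair_iff[OF opr_in_M] by blast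
qed

definition prods :: "'v set \<Rightarrow> 'v set \<Rightarrow> 'v set" where
  "prods S T = {opr x y | x y. x \<in> S \<and> y \<in> T}"

text \<open>A Kuratowski pair is a set of subsets of \<open>S \<union> T\<close>, so the product can
  be separated from a double power set.\<close>

lemma small_prods:
  assumes "small S" "small T"
  shows "small (prods S T)"
proof (rule small_subset_dfn)
  note M = subsetD[OF small_subset_M[OF assms(1)]] subsetD[OF small_subset_M[OF assms(2)]]
  let ?U = "{z \<in> M. el z \<subseteq> S \<union> T}"
  show "small {z \<in> M. el z \<subseteq> ?U}"
    using assms by (intro small_Pow small_Un)
  show "prods S T \<subseteq> {z \<in> M. el z \<subseteq> ?U}"
  proof -
    have "opr x y \<in> M \<and> el (opr x y) \<subseteq> ?U" if "x \<in> S" "y \<in> T" for x y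
      using that M opr_in_M[of x y] el_opr[of x y] el_st[OF small_singleton, of x]
        el_st[OF small_pair, of x y] st_in_M[OF small_singleton, of x] st_in_M[OF small_pair, of x y]
      by auto
    then show ?thesis by (auto simp: prods_def)
  qed
  show "dfn (\<lambda>s. s 0 \<in> prods S T)"
  proof (rule dfn_cong)
    show "dfn (\<lambda>s. \<exists>x\<in>S. \<exists>y\<in>T. is_opair M E (s 0) x y)"
      by (intro dfn_basic dfn_is_opair cls_small assms)
  qed (auto simp: prods_def is_opair_iff range_subsetD M)
qed

lemma prods_M: "small S \<Longrightarrow> small T \<Longrightarrow> p \<in> prods S T \<Longrightarrow> p \<in> M"
  using small_subset_M[OF small_prods] by blast

text \<open>The relation consists of HOL pairs; only their Kuratowski codes must form a set of the
  model. The rectangle keeps both coordinates in \<open>M\<close>, where \<open>opr\<close> is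
  injective.\<close>

definition smallrel :: "('v \<times> 'v) set \<Rightarrow> bool" where
  "smallrel r \<longleftrightarrow> (\<exists>S T. small S \<and> small T \<and> r \<subseteq> S \<times> T) \<and> small ((\<lambda>(x, y). opr x y) ` r)"

lemma smallrelI:
  assumes "small S" "small T" "r \<subseteq> S \<times> T" "dfn (\<lambda>s. (s 0, s 1) \<in> r)"
  shows "smallrel r"
proof -
  note M = subsetD[OF small_subset_M[OF assms(1)]] subsetD[OF small_subset_M[OF assms(2)]]
  have "small {p \<in> prods S T. \<exists>x\<in>S. \<exists>y\<in>T. is_opair M E p x y \<and> (x, y) \<in> r}"
    by (intro small_sep small_prods dfn_basic dfn_is_opair cls_small assms
        dfn_subst2[of "\<lambda>x y. (x, y) \<in> r"])
  also have "{p \<in> prods S T. \<exists>x\<in>S. \<exists>y\<in>T. is_opair M E p x y \<and> (x, y) \<in> r} = (\<lambda>(x, y). opr x y) ` r"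
  proof (intro equalityI subsetI)
    fix p assume p: "p \<in> {p \<in> prods S T. \<exists>x\<in>S. \<exists>y\<in>T. is_opair M E p x y \<and> (x, y) \<in> r}"
    then obtain x y where "(x, y) \<in> r" "is_opair M E p x y" by blast
    then show "p \<in> (\<lambda>(x, y). opr x y) ` r"
      using p is_opair_iff prods_M[OF assms(1,2)] by (auto intro: rev_image_eqI)
  next
    fix p assume "p \<in> (\<lambda>(x, y). opr x y) ` r"
    then obtain x y where "(x, y) \<in> r" "p = opr x y" by auto
    moreover from this have "x \<in> S" "y \<in> T" using assms(3) by auto
    ultimately show "p \<in> {p \<in> prods S T. \<exists>x\<in>S. \<exists>y\<in>T. is_opair M E p x y \<and> (x, y) \<in> r}"
      using is_opair_iff[OF opr_in_M[of x y]] M by (auto simp: prods_def)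
  qed
  finally show ?thesis using assms(1-3) by (auto simp: smallrel_def)
qed

lemma smallrel_code:
  assumes "smallrel r"
  shows "\<exists>f\<in>M. el f = (\<lambda>(x, y). opr x y) ` r \<and> (\<forall>x y. maps_to M E f x y \<longleftrightarrow> (x, y) \<in> r)"
proof -
  obtain S T where ST: "small S" "small T" "r \<subseteq> S \<times> T" and r: "small ((\<lambda>(x, y). opr x y) ` r)"
    using assms by (auto simp: smallrel_def)
  obtain f where f: "f \<in> M" "el f = (\<lambda>(x, y). opr x y) ` r" using r by (auto simp: small_def)
  have rM: "r \<subseteq> M \<times> M" using ST small_subset_M by blast
  have "maps_to M E f x y \<longleftrightarrow> (x, y) \<in> r" for x y
  proof
    assume "maps_to M E f x y"
    then obtain x' y' where "x \<in> M" "y \<in> M" "(x', y') \<in> r" "opr x y = opr x' y'"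
      by (auto simp: maps_to_iff f(2))
    then show "(x, y) \<in> r" using opr_inject[of x y x' y'] rM by auto
  next
    assume "(x, y) \<in> r"
    then show "maps_to M E f x y" using rM by (auto simp: maps_to_iff f(2))
  qed
  then show ?thesis using f by auto
qed

text \<open>The code of \<open>r\<close> enters the formula as a parameter, so relations built
  earlier can be used in later definitions.\<close>

lemma dfn_smallrel:
  assumes "smallrel r" "tm t" "tm u"
  shows "dfn (\<lambda>s. (t s, u s) \<in> r)"
proof -
  obtain f where f: "f \<in> M" "\<And>x y. maps_to M E f x y \<longleftrightarrow> (x, y) \<in> r"
    using smallrel_code[OF assms(1)] by blast
  have "dfn (\<lambda>s. maps_to M E f (t s) (u s))"
    by (intro dfn_maps_to tm_const f assms)
  then show ?thesis by (simp only: f(2))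
qed

subsection \<open>Functions\<close>

definition gr :: "'v set \<Rightarrow> ('v \<Rightarrow> 'v) \<Rightarrow> ('v \<times> 'v) set" where
  "gr S F = {(x, y). x \<in> S \<and> y = F x}"

lemma gr_iff: "(x, y) \<in> gr S F \<longleftrightarrow> x \<in> S \<and> y = F x"
  by (simp add: gr_def)

text \<open>Functions of the model are represented by HOL functions with unconstrained values off
  \<open>S\<close>, so that images, injectivity and inverses are the usual HOL notions.\<close>

definition sfun :: "'v set \<Rightarrow> ('v \<Rightarrow> 'v) \<Rightarrow> bool" where
  "sfun S F \<longleftrightarrow> small S \<and> smallrel (gr S F)"

text \<open>The graph is separated from the rectangle of \<open>S\<close> and \<open>T\<close>.
  Hence \<open>P\<close> has to be correct only there, and a codomain \<open>T\<close> known in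
  advance takes the place of replacement.\<close>

lemma sfunI:
  assumes "small S" "small T" "\<And>x. x \<in> S \<Longrightarrow> F x \<in> T" "dfn (\<lambda>s. P (s 0) (s 1))"
    "\<And>x y. x \<in> S \<Longrightarrow> y \<in> T \<Longrightarrow> P x y \<longleftrightarrow> y = F x"
  shows "sfun S F"
proof -
  have "smallrel (gr S F)"
  proof (rule smallrelI[OF assms(1,2)])
    show "gr S F \<subseteq> S \<times> T" using assms(3) by (auto simp: gr_def)
    show "dfn (\<lambda>s. (s 0, s 1) \<in> gr S F)"
    proof (rule dfn_cong)
      show "dfn (\<lambda>s. s 0 \<in> S \<and> s 1 \<in> T \<and> P (s 0) (s 1))"
        by (intro dfn_conj dfn_mem_cls cls_small tm_var assms)
    qed (use assms(3,5) in \<open>auto simp: gr_def\<close>)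
  qed
  then show ?thesis using assms(1) by (simp add: sfun_def)
qed

lemma sfun_small: "sfun S F \<Longrightarrow> small S"
  by (simp add: sfun_def)

lemma sfun_bound: "sfun S F \<Longrightarrow> \<exists>T. small T \<and> F ` S \<subseteq> T"
  unfolding sfun_def smallrel_def gr_def by blast

lemma dfn_gr: "sfun S F \<Longrightarrow> tm t \<Longrightarrow> tm u \<Longrightarrow> dfn (\<lambda>s. (t s, u s) \<in> gr S F)"
  by (simp add: sfun_def dfn_smallrel)

lemma sfun_subset:
  assumes "sfun S F" "small T" "T \<subseteq> S"
  shows "sfun T F"
proof -
  obtain U where U: "small U" "F ` S \<subseteq> U" using sfun_bound[OF assms(1)] by blast
  show ?thesis
  proof (rule sfunI[OF assms(2) U(1)])
    show "dfn (\<lambda>s. (s 0, s 1) \<in> gr S F)" by (intro dfn_gr tm_var assms)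
  qed (use assms U in \<open>auto simp: gr_iff\<close>)
qed

lemma sfun_id: "small S \<Longrightarrow> sfun S (\<lambda>x. x)"
  by (rule sfunI[of S S _ "\<lambda>x y. y = x"]) (auto intro: dfn_eq tm_var)

lemma sfun_const:
  assumes "small S" "c \<in> M"
  shows "sfun S (\<lambda>x. c)"
  by (rule sfunI[of S "{c}" _ "\<lambda>x y. y = c"])
    (auto intro!: dfn_eq tm_var tm_const small_singleton assms)

lemma sfun_image:
  assumes "sfun S F"
  shows "small (F ` S)"
proof -
  obtain U where U: "small U" "F ` S \<subseteq> U" using sfun_bound[OF assms] by blast
  have "small {y \<in> U. \<exists>x\<in>S. (x, y) \<in> gr S F}"
    by (intro small_sep U dfn_basic dfn_gr cls_small assms sfun_small[OF assms])
  also have "{y \<in> U. \<exists>x\<in>S. (x, y) \<in> gr S F} = F ` S"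
    using U(2) by (auto simp: gr_iff)
  finally show ?thesis .
qed

lemma sfun_comp:
  assumes "sfun S F" "sfun T G" "F ` S \<subseteq> T"
  shows "sfun S (\<lambda>x. G (F x))"
proof (rule sfunI)
  show "dfn (\<lambda>s. \<exists>z\<in>T. (s 0, z) \<in> gr S F \<and> (z, s 1) \<in> gr T G)"
    by (intro dfn_basic dfn_gr assms cls_small sfun_small[OF assms(2)])
  show "small (G ` T)" using assms sfun_image by blast
qed (use assms in \<open>auto simp: gr_iff sfun_def\<close>)

lemma sfun_inv:
  assumes "sfun S F" "inj_on F S"
  shows "sfun (F ` S) (inv_into S F)"
proof (rule sfunI[OF sfun_image[OF assms(1)] sfun_small[OF assms(1)]])
  show "dfn (\<lambda>s. (s 1, s 0) \<in> gr S F)" by (intro dfn_gr tm_var assms)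
qed (use assms in \<open>auto intro: inv_into_into simp: gr_iff\<close>)

lemma is_functionD:
  assumes "A \<in> M" "B \<in> M" and f: "is_function M E f A B"
  obtains F where "sfun (el A) F" "F ` el A \<subseteq> el B"
    "\<And>x y. maps_to M E f x y \<longleftrightarrow> x \<in> el A \<and> y = F x"
proof -
  define F where "F x = (THE y. y \<in> el B \<and> maps_to M E f x y)" for x
  have AB: "x \<in> el A \<and> y \<in> el B" if xy: "maps_to M E f x y" for x y
  proof -
    obtain p where p: "p \<in> el f" "is_opair M E p x y" using xy by (auto simp: maps_to_def)
    then obtain x' y' where "x' \<in> el A" "y' \<in> el B" "is_opair M E p x' y'"
      using f unfolding is_function_def by blast
    moreover have "x \<in> M \<and> y \<in> M \<and> p = opr x y" "x' \<in> M \<and> y' \<in> M \<and> p = opr x' y'"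
      using is_opair_iff[OF el_M[OF p(1)]] p(2) calculation(3) by simp_all
    ultimately show ?thesis using opr_inject[of x y x' y'] by metis
  qed
  have ex1: "\<exists>!y. y \<in> el B \<and> maps_to M E f x y" if "x \<in> el A" for x
    using f that unfolding is_function_def by blast
  have F: "F x \<in> el B \<and> maps_to M E f x (F x)" if "x \<in> el A" for x
    unfolding F_def by (rule theI'[OF ex1[OF that]])
  have iff: "maps_to M E f x y \<longleftrightarrow> x \<in> el A \<and> y = F x" for x y
  proof
    assume "maps_to M E f x y"
    then show "x \<in> el A \<and> y = F x" using AB[of x y] ex1[of x] F[of x] by blast
  qed (use F in blast)
  have "f \<in> M" using f by (simp add: is_function_def)
  then have "sfun (el A) F"
    by (intro sfunI[of _ "el B" _ "maps_to M E f"] small_el dfn_maps_to tm_var tm_const assms)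
      (use F iff in auto)
  then show thesis using that[of F] F iff by auto
qed

lemma is_functionI:
  assumes "A \<in> M" "B \<in> M" "sfun (el A) F" "F ` el A \<subseteq> el B"
  shows "\<exists>f\<in>M. is_function M E f A B \<and> (\<forall>x y. maps_to M E f x y \<longleftrightarrow> x \<in> el A \<and> y = F x)"
proof -
  obtain f where f: "f \<in> M" "el f = (\<lambda>(x, y). opr x y) ` gr (el A) F"
      "\<And>x y. maps_to M E f x y \<longleftrightarrow> (x, y) \<in> gr (el A) F"
    using smallrel_code[of "gr (el A) F"] assms(3) by (auto simp: sfun_def)
  have "\<exists>x\<in>el A. \<exists>y\<in>el B. is_opair M E p x y" if p: "p \<in> el f" for p
  proof -
    obtain x where "x \<in> el A" "p = opr x (F x)" using p unfolding f(2) by (auto simp: gr_def)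
    then show ?thesis using assms(4) is_opair_iff[OF el_M[OF p]] el_M by blast
  qed
  moreover have "\<exists>!y. y \<in> el B \<and> maps_to M E f x y" if "x \<in> el A" for x
    using that assms(4) by (auto simp: f(3) gr_iff)
  ultimately have "is_function M E f A B" using f(1) by (simp add: is_function_def)
  then show ?thesis using f by (auto simp: gr_iff)
qed

lemma bijection_iff:
  assumes "A \<in> M" "B \<in> M"
  shows "(\<exists>f\<in>M. is_bijection M E f A B) \<longleftrightarrow> (\<exists>F. sfun (el A) F \<and> bij_betw F (el A) (el B))"
proof
  assume "\<exists>f\<in>M. is_bijection M E f A B"
  then obtain f where f: "is_function M E f A B"
      "\<And>y. y \<in> el B \<Longrightarrow> \<exists>!x. x \<in> el A \<and> maps_to M E f x y"
    by (auto simp: is_bijection_def)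
  obtain F where F: "sfun (el A) F" "F ` el A \<subseteq> el B"
    "\<And>x y. maps_to M E f x y \<longleftrightarrow> x \<in> el A \<and> y = F x"
    using is_functionD[OF assms f(1)] by blast
  have ex1: "\<exists>!x. x \<in> el A \<and> y = F x" if "y \<in> el B" for y
    using f(2)[OF that] by (simp add: F(3))
  have "bij_betw F (el A) (el B)"
  proof (rule bij_betw_imageI)
    show "inj_on F (el A)"
    proof (rule inj_onI)
      fix x y assume xy: "x \<in> el A" "y \<in> el A" "F x = F y"
      then have "F x \<in> el B" using F(2) by blast
      then show "x = y" using ex1[of "F x"] xy by metis
    qed
    show "F ` el A = el B"
    proof
      show "el B \<subseteq> F ` el A"
      proof
        fix y assume "y \<in> el B"
        from ex1[OF this] obtain x where "x \<in> el A" "y = F x" by (elim ex1E conjE)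
        then show "y \<in> F ` el A" by simp
      qed
    qed (use F(2) in simp)
  qed
  then show "\<exists>F. sfun (el A) F \<and> bij_betw F (el A) (el B)" using F(1) by blast
next
  assume "\<exists>F. sfun (el A) F \<and> bij_betw F (el A) (el B)"
  then obtain F where F: "sfun (el A) F" "bij_betw F (el A) (el B)" by blast
  then obtain f where f: "f \<in> M" "is_function M E f A B"
      "\<And>x y. maps_to M E f x y \<longleftrightarrow> x \<in> el A \<and> y = F x"
    using is_functionI[OF assms F(1)] by (auto simp: bij_betw_def)
  have "\<exists>!x. x \<in> el A \<and> maps_to M E f x y" if "y \<in> el B" for y
  proof -
    have "inj_on F (el A)" "y \<in> F ` el A" using F(2) that by (auto simp: bij_betw_def)
    then obtain x where "x \<in> el A" "y = F x" by blast
    then show ?thesis using \<open>inj_on F (el A)\<close> by (auto simp: f(3) inj_on_def intro!: ex1I[of _ x])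
  qed
  then have "is_bijection M E f A B" using f(2) by (simp add: is_bijection_def)
  then show "\<exists>f\<in>M. is_bijection M E f A B" using f(1) by blast
qed

section \<open>Choice, injections and well-orders in the model\<close>


text \<open>The axiom selects from families of disjoint sets. Tagging the candidates for
  \<open>x\<close> with \<open>x\<close> itself, as the set \<open>B x\<close> of pairs, makes them
  disjoint. The selector meets each \<open>B x\<close> in one pair, and \<open>F\<close> is read off
  from these pairs.\<close>

lemma choice_function:
  assumes S: "small S" and T: "small T" and R: "dfn (\<lambda>s. R (s 0) (s 1))"
    and ex: "\<And>x. x \<in> S \<Longrightarrow> \<exists>y\<in>T. R x y"
  shows "\<exists>F. sfun S F \<and> (\<forall>x\<in>S. F x \<in> T \<and> R x (F x))"
proof -
  note M = subsetD[OF small_subset_M[OF S]] subsetD[OF small_subset_M[OF T]]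
  define B where "B x = {p \<in> prods S T. \<exists>y\<in>T. is_opair M E p x y \<and> R x y}" for x
  have small_B: "small (B x)" if "x \<in> S" for x
    unfolding B_def
    by (intro small_sep small_prods S T dfn_basic dfn_is_opair cls_small R
        dfn_subst2[of R] M(1)[OF that])
  have B_iff: "p \<in> B x \<longleftrightarrow> (\<exists>y\<in>T. p = opr x y \<and> R x y)" if "x \<in> S" for x p
    unfolding B_def using that is_opair_iff[OF opr_in_M] is_opair_iff[OF prods_M[OF S T]] M
    by (auto simp: prods_def; blast)
  \<comment> \<open>The family of all \<open>B x\<close>, separated from a power set by describing
    the elements of its members.\<close>
  define C where "C = {z \<in> {z \<in> M. el z \<subseteq> prods S T}. \<exists>x\<in>S. \<forall>p\<in>prods S T.
    p \<in> el z \<longleftrightarrow> (\<exists>y\<in>T. is_opair M E p x y \<and> R x y)}"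
  have small_C: "small C"
    unfolding C_def
    by (intro small_sep small_Pow small_prods S T dfn_basic dfn_is_opair cls_small R dfn_subst2[of R])
  have C_iff: "z \<in> C \<longleftrightarrow> (\<exists>x\<in>S. z = st (B x))" for z
  proof
    assume "z \<in> C"
    then obtain x where x: "x \<in> S" "z \<in> M" "el z \<subseteq> prods S T"
        "\<forall>p\<in>prods S T. p \<in> el z \<longleftrightarrow> (\<exists>y\<in>T. is_opair M E p x y \<and> R x y)"
      by (auto simp: C_def)
    then have "el z = B x" by (auto simp: B_def)
    then show "\<exists>x\<in>S. z = st (B x)" using st_el[OF x(2)] x(1) by metis
  next
    assume "\<exists>x\<in>S. z = st (B x)"
    then obtain x where x: "x \<in> S" "z = st (B x)" by blast
    then have "el z = B x" "z \<in> M" using st[OF small_B] by auto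
    then show "z \<in> C" using x(1) by (auto simp: C_def B_def)
  qed
  have el_C: "z \<in> el (st C) \<longleftrightarrow> (\<exists>x\<in>S. z = st (B x))" for z
    using C_iff by (simp add: el_st[OF small_C])
  have el_B: "el (st (B x)) = B x" if "x \<in> S" for x
    by (rule el_st[OF small_B[OF that]])
  have ne: "\<forall>y\<in>el (st C). el y \<noteq> {}"
  proof
    fix y assume "y \<in> el (st C)"
    then obtain x where x: "x \<in> S" "y = st (B x)" using el_C by blast
    then obtain t where "t \<in> T" "R x t" using ex by blast
    then have "opr x t \<in> B x" using B_iff[OF x(1)] by blast
    then show "el y \<noteq> {}" using el_B x by auto
  qed
  have disj: "\<forall>y\<in>el (st C). \<forall>z\<in>el (st C). y \<noteq> z \<longrightarrow> el y \<inter> el z = {}"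
  proof (intro ballI impI)
    fix y z assume "y \<in> el (st C)" "z \<in> el (st C)" "y \<noteq> z"
    then obtain x x' where x: "x \<in> S" "y = st (B x)" "x' \<in> S" "z = st (B x')" using el_C by blast
    then have "x \<noteq> x'" using \<open>y \<noteq> z\<close> by blast
    show "el y \<inter> el z = {}"
    proof (rule ccontr)
      assume "el y \<inter> el z \<noteq> {}"
      then obtain p where "p \<in> B x" "p \<in> B x'" using el_B x by auto
      then obtain t t' where "t \<in> T" "t' \<in> T" "opr x t = opr x' t'"
        using B_iff[OF x(1)] B_iff[OF x(3)] by metis
      then show False using opr_inject[of x t x' t'] M x \<open>x \<noteq> x'\<close> by blast
    qed
  qed
  have "\<exists>c\<in>M. \<forall>y\<in>el (st C). \<exists>!z. z \<in> el y \<inter> el c"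
    using zfc st_in_M[OF small_C] ne disj unfolding ZFC_model_def ax_choice_def by blast
  then obtain c where c: "c \<in> M" "\<And>y. y \<in> el (st C) \<Longrightarrow> \<exists>!z. z \<in> el y \<inter> el c" by blast
  define F where "F x = (THE y. y \<in> T \<and> R x y \<and> maps_to M E c x y)" for x
  have ex1: "\<exists>!y. y \<in> T \<and> R x y \<and> maps_to M E c x y" if x: "x \<in> S" for x
  proof -
    have "\<exists>!z. z \<in> B x \<inter> el c" using c(2)[of "st (B x)"] el_C el_B[OF x] x by auto
    then obtain z where z: "z \<in> B x" "z \<in> el c" "\<And>z'. z' \<in> B x \<Longrightarrow> z' \<in> el c \<Longrightarrow> z' = z" by blast
    then obtain y where y: "y \<in> T" "R x y" "z = opr x y" using B_iff[OF x] by blast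
    show ?thesis
    proof (rule ex1I[of _ y])
      show "y \<in> T \<and> R x y \<and> maps_to M E c x y"
        using y z(2) M(1)[OF x] M(2)[OF y(1)] by (simp add: maps_to_iff)
      fix y' assume y': "y' \<in> T \<and> R x y' \<and> maps_to M E c x y'"
      then have "opr x y' \<in> B x" "opr x y' \<in> el c" using B_iff[OF x] by (auto simp: maps_to_iff)
      then have "opr x y' = opr x y" using z(3)[of "opr x y'"] y(3) by simp
      then show "y' = y" using opr_inject[of x y' x y] M x y' y by blast
    qed
  qed
  have F: "F x \<in> T \<and> R x (F x) \<and> maps_to M E c x (F x)" if "x \<in> S" for x
    unfolding F_def by (rule theI'[OF ex1[OF that]])
  have "sfun S F"
  proof (rule sfunI[OF S T])
    show "dfn (\<lambda>s. s 1 \<in> T \<and> R (s 0) (s 1) \<and> maps_to M E c (s 0) (s 1))"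
      by (intro dfn_basic dfn_maps_to cls_small T R c)
    show "y \<in> T \<and> R x y \<and> maps_to M E c x y \<longleftrightarrow> y = F x" if "x \<in> S" "y \<in> T" for x y
      using F[OF that(1)] ex1[OF that(1)] by metis
  qed (use F in blast)
  then show ?thesis using F by blast
qed

text \<open>The Cantor--Bernstein argument: iterate \<open>F\<close> on the part of \<open>A\<close> outside \<open>B\<close>, and fix the rest.\<close>

lemma bij_of_inj_into_subset:
  assumes F: "sfun A F" and inj: "inj_on F A" and FB: "F ` A \<subseteq> B" and BA: "B \<subseteq> A" and B: "small B"
  shows "\<exists>H. sfun A H \<and> bij_betw H A B"
proof -
  note A = sfun_small[OF F]
  define cl where "cl Z \<longleftrightarrow> (\<forall>z\<in>A. z \<notin> B \<longrightarrow> z \<in> el Z) \<and>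
    (\<forall>z\<in>A. z \<in> el Z \<longrightarrow> (\<forall>w\<in>A. (z, w) \<in> gr A F \<longrightarrow> w \<in> el Z))" for Z
  have cl_iff: "cl Z \<longleftrightarrow> A - B \<subseteq> el Z \<and> (\<forall>z\<in>A \<inter> el Z. F z \<in> el Z)" for Z
    using FB BA by (auto simp: cl_def gr_iff)
  \<comment> \<open>The least closed set, taken as an intersection: it stands for the union of the
    iterated images of \<open>A - B\<close>.\<close>
  define C where "C = {x \<in> A. \<forall>Z\<in>M. cl Z \<longrightarrow> x \<in> el Z}"
  have small_C: "small C"
    unfolding C_def cl_def by (intro small_sep A dfn_basic dfn_gr F cls_small B)
  have CA: "C \<subseteq> A" by (auto simp: C_def)
  have C1: "A - B \<subseteq> C" by (auto simp: C_def cl_iff)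
  have C2: "F x \<in> C" if "x \<in> C" for x
    using that FB BA by (auto simp: C_def cl_iff)
  have C3: "\<exists>x\<in>C. y = F x" if y: "y \<in> C" "y \<in> B" for y
  proof (rule ccontr)
    \<comment> \<open>Removing such a \<open>y\<close> would leave a smaller closed set, because
      \<open>y\<close> lies in \<open>B\<close> and so is not among the starting points.\<close>
    assume n: "\<not> (\<exists>x\<in>C. y = F x)"
    have sm: "small (C - {y})"
      using small_C y small_subset_M[OF B] by (intro small_Diff small_singleton) auto
    have "cl (st (C - {y}))" using n C1 C2 y by (auto simp: cl_iff el_st[OF sm])
    then have "y \<in> C - {y}" using y st[OF sm] by (auto simp: C_def)
    then show False by simp
  qed
  define H where "H x = (if x \<in> C then F x else x)" for x
  have "sfun A H"
  proof (rule sfunI[OF A A])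
    show "dfn (\<lambda>s. s 0 \<in> C \<and> (s 0, s 1) \<in> gr A F \<or> s 0 \<notin> C \<and> s 1 = s 0)"
      by (intro dfn_basic dfn_gr F cls_small small_C)
  qed (use FB BA in \<open>auto simp: H_def gr_iff\<close>)
  moreover have "bij_betw H A B"
  proof (rule bij_betw_imageI)
    show "inj_on H A"
    proof (rule inj_onI)
      fix x y assume xy: "x \<in> A" "y \<in> A" "H x = H y"
      then show "x = y" using inj_onD[OF inj, of x y] C2[of x] C2[of y]
        by (auto simp: H_def split: if_splits)
    qed
    show "H ` A = B"
    proof (intro equalityI subsetI)
      fix y assume "y \<in> H ` A"
      then show "y \<in> B" using FB C1 by (auto simp: H_def split: if_splits)
    next
      fix y assume y: "y \<in> B"
      show "y \<in> H ` A"
      proof (cases "y \<in> C")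
        case True
        then obtain x where "x \<in> C" "y = F x" using C3 y by blast
        then have "y = H x" "x \<in> A" using CA by (auto simp: H_def)
        then show ?thesis by blast
      next
        case False
        then have "y = H y" "y \<in> A" using BA y by (auto simp: H_def)
        then show ?thesis by blast
      qed
    qed
  qed
  ultimately show ?thesis by blast
qed

section \<open>Internal well-orders and their comparison\<close>

text \<open>Least elements are demanded only of sets of the model, so the order may be ill-founded
  from outside. Arguments by least counterexample must therefore first separate the set of
  counterexamples.\<close>

definition wo :: "'v set \<Rightarrow> ('v \<Rightarrow> 'v \<Rightarrow> bool) \<Rightarrow> bool" where
  "wo S R \<longleftrightarrow> (\<forall>x\<in>S. \<not> R x x) \<and> (\<forall>x\<in>S. \<forall>y\<in>S. \<forall>z\<in>S. R x y \<longrightarrow> R y z \<longrightarrow> R x z) \<and>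
     (\<forall>x\<in>S. \<forall>y\<in>S. R x y \<or> x = y \<or> R y x) \<and>
     (\<forall>Z. small Z \<and> Z \<subseteq> S \<and> Z \<noteq> {} \<longrightarrow> (\<exists>m\<in>Z. \<forall>z\<in>Z. m = z \<or> R m z))"

lemma wo_irrefl: "wo S R \<Longrightarrow> x \<in> S \<Longrightarrow> \<not> R x x"
  by (simp add: wo_def)

lemma wo_trans:
  assumes "wo S R" "x \<in> S" "y \<in> S" "z \<in> S" "R x y" "R y z"
  shows "R x z"
  using assms(1)[unfolded wo_def, THEN conjunct2, THEN conjunct1] assms(2-) by blast

lemma wo_asym: "wo S R \<Longrightarrow> x \<in> S \<Longrightarrow> y \<in> S \<Longrightarrow> R x y \<Longrightarrow> \<not> R y x"
  using wo_irrefl wo_trans by metis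

lemma wo_linear:
  assumes "wo S R" "x \<in> S" "y \<in> S"
  shows "R x y \<or> x = y \<or> R y x"
  using assms(1)[unfolded wo_def, THEN conjunct2, THEN conjunct2, THEN conjunct1] assms(2-) by blast

lemma wo_least:
  assumes "wo S R" "small Z" "Z \<subseteq> S" "Z \<noteq> {}"
  shows "\<exists>m\<in>Z. \<forall>z\<in>Z. m = z \<or> R m z"
  using assms(1)[unfolded wo_def, THEN conjunct2, THEN conjunct2, THEN conjunct2] assms(2-) by blast

lemma wo_subset:
  assumes "wo S R" "T \<subseteq> S"
  shows "wo T R"
proof -
  have "\<exists>m\<in>Z. \<forall>z\<in>Z. m = z \<or> R m z" if Z: "small Z" "Z \<subseteq> T" "Z \<noteq> {}" for Z
    using wo_least[OF assms(1) Z(1) order_trans[OF Z(2) assms(2)] Z(3)] by metis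
  then show ?thesis
    unfolding wo_def using wo_irrefl[OF assms(1)] wo_trans[OF assms(1)] wo_linear[OF assms(1)] assms(2)
    by (simp add: subset_iff; metis)
qed

text \<open>The union of all isomorphisms between initial segments is one, and it exhausts a side.\<close>

lemma wo_compare:
  assumes S: "small S" and T: "small T" and woS: "wo S R" and woT: "wo T Q"
    and R: "dfn (\<lambda>s. R (s 0) (s 1))" and Q: "dfn (\<lambda>s. Q (s 0) (s 1))"
  shows "(\<exists>H. sfun S H \<and> inj_on H S \<and> H ` S \<subseteq> T \<and> (\<forall>x\<in>S. \<forall>y\<in>T. Q y (H x) \<longrightarrow> y \<in> H ` S)) \<or>
    (\<exists>x\<in>S. \<exists>H. sfun T H \<and> inj_on H T \<and> H ` T \<subseteq> {y \<in> S. R y x})"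
proof -
  \<comment> \<open>Restricted to \<open>S\<close> and \<open>T\<close>, such a \<open>P\<close> is
    an isomorphism between initial segments. The equivalence of the two orders together with
    linearity makes it single-valued in both directions.\<close>
  define good where "good P \<longleftrightarrow> (\<forall>x\<in>S. \<forall>t\<in>T. P x t \<longrightarrow>
      (\<forall>x'\<in>S. \<forall>t'\<in>T. P x' t' \<longrightarrow> (R x x' \<longleftrightarrow> Q t t')) \<and>
      (\<forall>x'\<in>S. R x' x \<longrightarrow> (\<exists>t'\<in>T. P x' t')) \<and> (\<forall>t'\<in>T. Q t' t \<longrightarrow> (\<exists>x'\<in>S. P x' t')))"
    for P :: "'v \<Rightarrow> 'v \<Rightarrow> bool"
  \<comment> \<open>Only isomorphisms coded in \<open>M\<close> are joined, which keeps
    \<open>h\<close> definable.\<close>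
  define h where "h x t \<longleftrightarrow> x \<in> S \<and> t \<in> T \<and> (\<exists>f\<in>M. good (maps_to M E f) \<and> maps_to M E f x t)" for x t
  have dfn_h: "dfn (\<lambda>s. h (s 0) (s 1))"
    unfolding h_def good_def
    by (intro dfn_basic dfn_maps_to cls_small S T dfn_subst2[OF R] dfn_subst2[OF Q])
  have good_iso: "R x x' \<longleftrightarrow> Q t t'"
    if "good P" "x \<in> S" "t \<in> T" "P x t" "x' \<in> S" "t' \<in> T" "P x' t'" for P x t x' t'
    using that unfolding good_def by blast
  have good_down: "\<exists>t'\<in>T. P x' t'" if "good P" "x \<in> S" "t \<in> T" "P x t" "x' \<in> S" "R x' x" for P x t x'
    using that unfolding good_def by blast
  have good_down': "\<exists>x'\<in>S. P x' t'" if "good P" "x \<in> S" "t \<in> T" "P x t" "t' \<in> T" "Q t' t" for P x t t'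
    using that unfolding good_def by blast
  have good_inj: "x = x'" if "good P" "x \<in> S" "t \<in> T" "P x t" "x' \<in> S" "P x' t" for P x t x'
    using good_iso[OF that(1-4) that(5) that(3) that(6)] good_iso[OF that(1,5,3,6,2,3,4)]
      wo_irrefl[OF woT that(3)] wo_linear[OF woS that(2,5)] by blast
  \<comment> \<open>At the least point \<open>x0\<close> of disagreement, the smaller value is
    attained by the other isomorphism at some \<open>x'\<close> before \<open>x0\<close>. Both agree
    at \<open>x'\<close>, against injectivity.\<close>
  have fun_eq: "t = t'"
    if fg: "f \<in> M" "g \<in> M" "good (maps_to M E f)" "good (maps_to M E g)"
      and xt: "x \<in> S" "t \<in> T" "t' \<in> T" "maps_to M E f x t" "maps_to M E g x t'" for f g x t t'
  proof (rule ccontr)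
    assume "t \<noteq> t'"
    let ?Z = "{x \<in> S. \<exists>t\<in>T. \<exists>t'\<in>T. maps_to M E f x t \<and> maps_to M E g x t' \<and> t \<noteq> t'}"
    have Z: "small ?Z" "?Z \<subseteq> S" by (intro small_sep S dfn_basic dfn_maps_to cls_small T fg) blast
    have ne: "?Z \<noteq> {}" using xt \<open>t \<noteq> t'\<close> by blast
    obtain x0 where x0: "x0 \<in> ?Z" "\<forall>z\<in>?Z. x0 = z \<or> R x0 z"
      using wo_least[OF woS Z ne] by (elim bexE)
    then obtain t0 t1 where t: "x0 \<in> S" "t0 \<in> T" "t1 \<in> T" "maps_to M E f x0 t0" "maps_to M E g x0 t1" "t0 \<noteq> t1"
      by blast
    have min: "u = u'" if "z \<in> S" "R z x0" "u \<in> T" "u' \<in> T" "maps_to M E f z u" "maps_to M E g z u'" for z u u'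
      using bspec[OF x0(2), of z] that wo_asym[OF woS that(1) t(1)] wo_irrefl[OF woS t(1)] by blast
    from wo_linear[OF woT t(2,3)] t(6) consider "Q t0 t1" | "Q t1 t0" by blast
    then show False
    proof cases
      case 1
      then obtain x' where x': "x' \<in> S" "maps_to M E g x' t0"
        using good_down'[OF fg(4) t(1,3,5,2)] by blast
      then have Rx: "R x' x0" using good_iso[OF fg(4) x'(1) t(2) x'(2) t(1,3,5)] 1 by blast
      then obtain u where u: "u \<in> T" "maps_to M E f x' u" using good_down[OF fg(3) t(1,2,4) x'(1)] by blast
      have "u = t0" by (rule min[OF x'(1) Rx u(1) t(2) u(2) x'(2)])
      then have "x' = x0" using good_inj[OF fg(3) x'(1) t(2) _ t(1,4)] u(2) by blast
      then show False using Rx wo_irrefl[OF woS t(1)] by blast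
    next
      case 2
      then obtain x' where x': "x' \<in> S" "maps_to M E f x' t1"
        using good_down'[OF fg(3) t(1,2,4,3)] by blast
      then have Rx: "R x' x0" using good_iso[OF fg(3) x'(1) t(3) x'(2) t(1,2,4)] 2 by blast
      then obtain u where u: "u \<in> T" "maps_to M E g x' u" using good_down[OF fg(4) t(1,3,5) x'(1)] by blast
      have "t1 = u" by (rule min[OF x'(1) Rx t(3) u(1) x'(2) u(2)])
      then have "x' = x0" using good_inj[OF fg(4) x'(1) t(3) _ t(1,5)] u(2) by blast
      then show False using Rx wo_irrefl[OF woS t(1)] by blast
    qed
  qed
  have hD: "\<exists>f\<in>M. good (maps_to M E f) \<and> maps_to M E f x t \<and>
      (\<forall>x' t'. x' \<in> S \<longrightarrow> t' \<in> T \<longrightarrow> maps_to M E f x' t' \<longrightarrow> h x' t')" if "h x t" for x t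
    using that unfolding h_def by blast
  have iso: "Q t t'" if hh: "h x t" "h x' t'" "R x x'" for x t x' t'
  proof -
    obtain f where f: "f \<in> M" "good (maps_to M E f)" "maps_to M E f x t" using hh(1) by (auto simp: h_def)
    obtain g where g: "g \<in> M" "good (maps_to M E g)" "maps_to M E g x' t'" using hh(2) by (auto simp: h_def)
    have m: "x \<in> S" "t \<in> T" "x' \<in> S" "t' \<in> T" using hh by (auto simp: h_def)
    obtain u where u: "u \<in> T" "maps_to M E g x u" using good_down[OF g(2) m(3,4) g(3) m(1) hh(3)] by blast
    then have "u = t" using fun_eq[OF f(1) g(1) f(2) g(2) m(1,2) u(1) f(3) u(2)] by simp
    then show ?thesis using good_iso[OF g(2) m(1,2) _ m(3,4) g(3)] u(2) hh(3) by blast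
  qed
  have h_fun: "t = t'" if "h x t" "h x t'" for x t t'
    using that fun_eq unfolding h_def by blast
  have good_h: "good h"
    unfolding good_def
  proof (intro ballI impI conjI)
    fix x t assume xt: "x \<in> S" "t \<in> T" "h x t"
    show "\<exists>t'\<in>T. h x' t'" if "x' \<in> S" "R x' x" for x'
      using hD[OF xt(3)] good_down[OF _ xt(1,2) _ that] that by blast
    show "\<exists>x'\<in>S. h x' t'" if "t' \<in> T" "Q t' t" for t'
      using hD[OF xt(3)] good_down'[OF _ xt(1,2) _ that] that by blast
    fix x' t' assume xt': "x' \<in> S" "t' \<in> T" "h x' t'"
    show "R x x' \<longleftrightarrow> Q t t'"
      using iso[OF xt(3) xt'(3)] iso[OF xt'(3) xt(3)] h_fun[OF xt(3), of t'] xt'(3)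
        wo_linear[OF woS xt(1) xt'(1)] wo_asym[OF woT xt(2) xt'(2)] wo_irrefl[OF woT xt(2)] by blast
  qed
  define r where "r = {(x, t). h x t}"
  have r: "smallrel r"
    by (rule smallrelI[OF S T]) (use dfn_h in \<open>auto simp: r_def h_def\<close>)
  define D where "D = {x \<in> S. \<exists>t\<in>T. h x t}"
  define I where "I = {t \<in> T. \<exists>x\<in>S. h x t}"
  have D: "small D" and I: "small I"
    unfolding D_def I_def by (intro small_sep S T dfn_basic cls_small dfn_subst2[OF dfn_h])+
  have hST: "x \<in> S" "t \<in> T" if "h x t" for x t using that by (auto simp: h_def)
  have h_inj: "x = x'" if "h x t" "h x' t" for x x' t
    using good_inj[OF good_h] that hST by blast
  show ?thesis
  proof (cases "D = S")
    case True
    define H where "H x = (THE t. h x t)" for x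
    have H: "h x t \<longleftrightarrow> t = H x" if xS: "x \<in> S" for x t
    proof -
      obtain u where u: "h x u" using True xS by (auto simp: D_def)
      then have "H x = u" unfolding H_def using h_fun by blast
      then show ?thesis using u h_fun by blast
    qed
    have HT: "H x \<in> T" if "x \<in> S" for x using H[OF that] hST by blast
    have s1: "sfun S H"
      by (rule sfunI[OF S T _ dfn_h]) (use HT H in auto)
    have s2: "inj_on H S" using H h_inj by (metis inj_onI)
    have s3: "y \<in> H ` S" if "x \<in> S" "y \<in> T" "Q y (H x)" for x y
    proof -
      have "\<exists>x'\<in>S. h x' y" using good_down'[OF good_h that(1) HT[OF that(1)] _ that(2,3)] H[OF that(1)] by blast
      then show ?thesis using H by blast
    qed
    have "H ` S \<subseteq> T" using HT by blast
    then show ?thesis using s1 s2 s3 by (intro disjI1 exI[of _ H] conjI ballI impI)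
  next
    case False
    then have ne: "S - D \<noteq> {}" by (auto simp: D_def)
    obtain x where x: "x \<in> S - D" "\<forall>z\<in>S - D. x = z \<or> R x z"
      using wo_least[OF woS small_Diff[OF S D] Diff_subset ne] by (elim bexE)
    have below: "R z x" if "h z t" for z t
    proof -
      have z: "z \<in> S" "t \<in> T" using hST[OF that] by auto
      have "z \<in> D" using that z by (auto simp: D_def)
      moreover have "\<not> R x z"
      proof
        assume "R x z"
        then have "\<exists>t'\<in>T. h x t'" using good_down[OF good_h z that] x(1) by blast
        then show False using x(1) by (auto simp: D_def)
      qed
      ultimately show ?thesis using wo_linear[OF woS z(1), of x] x(1) by blast
    qed
    have "I = T"
    proof (rule ccontr)
      assume "I \<noteq> T"
      then have ne: "T - I \<noteq> {}" by (auto simp: I_def)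
      obtain t where t: "t \<in> T - I" "\<forall>z\<in>T - I. t = z \<or> Q t z"
      using wo_least[OF woT small_Diff[OF T I] Diff_subset ne] by (elim bexE)
      have below': "Q u t" if "h z u" for z u
      proof -
        have z: "z \<in> S" "u \<in> T" using hST[OF that] by auto
        have "u \<in> I" using that z by (auto simp: I_def)
        moreover have "\<not> Q t u"
        proof
          assume "Q t u"
          then have "\<exists>x'\<in>S. h x' t" using good_down'[OF good_h z that] t(1) by blast
          then show False using t(1) by (auto simp: I_def)
        qed
        ultimately show ?thesis using wo_linear[OF woT z(2), of t] t(1) by blast
      qed
      \<comment> \<open>\<open>D\<close> and \<open>I\<close> are the segments below
        \<open>x\<close> and \<open>t\<close>, so adding this pair keeps an isomorphism. It is then
        one of those joined in \<open>h\<close>, although \<open>x\<close> is outside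
        \<open>D\<close>.\<close>
      let ?k = "\<lambda>y u. h y u \<or> y = x \<and> u = t"
      have xS: "x \<in> S" "t \<in> T" using x(1) t(1) by auto
      then have xM: "x \<in> M" "t \<in> M" using small_subset_M S T by auto
      have "smallrel {(y, u). ?k y u}"
      proof (rule smallrelI[OF S T])
        show "dfn (\<lambda>s. (s 0, s 1) \<in> {(y, u). ?k y u})"
          unfolding mem_Collect_eq case_prod_conv
          by (intro dfn_basic dfn_subst2[OF dfn_h] xM)
      qed (use hST xS in auto)
      then obtain f where f: "f \<in> M" "\<And>y u. maps_to M E f y u \<longleftrightarrow> ?k y u"
        using smallrel_code by fastforce
      have "good ?k"
        unfolding good_def
      proof (intro ballI impI conjI)
        fix y u assume yu: "y \<in> S" "u \<in> T" "?k y u"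
        show "\<exists>u'\<in>T. ?k y' u'" if y': "y' \<in> S" "R y' y" for y'
        proof (cases "h y u")
          case True
          then show ?thesis using good_down[OF good_h yu(1,2) True y'] by blast
        next
          case False
          then have "R y' x" using yu(3) y' by blast
          then have "y' \<in> D" using bspec[OF x(2), of y'] y'(1) wo_asym[OF woS y'(1) xS(1)] wo_irrefl[OF woS xS(1)] by blast
          then show ?thesis by (auto simp: D_def)
        qed
        show "\<exists>y'\<in>S. ?k y' u'" if u': "u' \<in> T" "Q u' u" for u'
        proof (cases "h y u")
          case True
          then show ?thesis using good_down'[OF good_h yu(1,2) True u'] by blast
        next
          case False
          then have "Q u' t" using yu(3) u' by blast
          then have "u' \<in> I" using bspec[OF t(2), of u'] u'(1) wo_asym[OF woT u'(1) xS(2)] wo_irrefl[OF woT xS(2)] by blast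
          then show ?thesis by (auto simp: I_def)
        qed
        fix y' u' assume yu': "y' \<in> S" "u' \<in> T" "?k y' u'"
        show "R y y' \<longleftrightarrow> Q u u'"
        proof (cases "h y u")
          case True
          show ?thesis
          proof (cases "h y' u'")
            case h': True
            show ?thesis by (rule good_iso[OF good_h yu(1,2) True yu'(1,2) h'])
          next
            case False
            then show ?thesis using yu'(3) below[OF True] below'[OF True] by blast
          qed
        next
          case False
          then have e: "y = x" "u = t" using yu(3) by auto
          show ?thesis
          proof (cases "h y' u'")
            case h': True
            then show ?thesis unfolding e
              using below[OF h'] below'[OF h'] wo_asym[OF woS xS(1) yu'(1)] wo_asym[OF woT xS(2) yu'(2)] by blast
          next
            case False
            then show ?thesis using yu'(3) e wo_irrefl[OF woS xS(1)] wo_irrefl[OF woT xS(2)] by blast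
          qed
        qed
      qed
      moreover have "maps_to M E f = ?k" using f(2) by (auto simp: fun_eq_iff)
      ultimately have "good (maps_to M E f)" "maps_to M E f x t" using f(2)[of x t] by simp_all
      then have "h x t" using f(1) xS unfolding h_def by blast
      then show False using x(1) xS by (auto simp: D_def)
    qed
    define H where "H t = (THE x. h x t)" for t
    have H: "h x t \<longleftrightarrow> x = H t" if tT: "t \<in> T" for x t
    proof -
      obtain u where u: "h u t" using \<open>I = T\<close> tT by (auto simp: I_def)
      then have "H t = u" unfolding H_def using h_inj by blast
      then show ?thesis using u h_inj by blast
    qed
    have HS: "H t \<in> S" "R (H t) x" if "t \<in> T" for t using H[OF that] hST below by blast+
    have s1: "sfun T H"
    proof (rule sfunI[OF T S])
      show "dfn (\<lambda>s. h (s 1) (s 0))" by (intro dfn_subst2[OF dfn_h] tm_var)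
    qed (use HS H in auto)
    have s2: "inj_on H T" using H h_fun by (metis inj_onI)
    have "H ` T \<subseteq> {y \<in> S. R y x}" using HS by blast
    then show ?thesis using s1 s2 x(1) by (intro disjI2 bexI[of _ x] exI[of _ H] conjI) auto
  qed
qed

section \<open>Ordinals and cardinals\<close>


lemma is_ordinal_in_M: "is_ordinal M E a \<Longrightarrow> a \<in> M"
  by (simp add: is_ordinal_def)

lemma is_ordinal_wo:
  assumes "is_ordinal M E a"
  shows "wo (el a) E"
proof -
  have "\<exists>m\<in>Z. \<forall>z\<in>Z. m = z \<or> E m z" if "small Z" "Z \<subseteq> el a" "Z \<noteq> {}" for Z
  proof -
    obtain z where "z \<in> M" "el z = Z" using \<open>small Z\<close> by (auto simp: small_def)
    then show ?thesis using assms that unfolding is_ordinal_def by blast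
  qed
  then have 4: "\<forall>Z. small Z \<and> Z \<subseteq> el a \<and> Z \<noteq> {} \<longrightarrow> (\<exists>m\<in>Z. \<forall>z\<in>Z. m = z \<or> E m z)"
    by (intro allI impI) (elim conjE)
  have "(\<forall>y\<in>el a. \<not> E y y) \<and>
      (\<forall>y\<in>el a. \<forall>z\<in>el a. \<forall>w\<in>el a. E y z \<longrightarrow> E z w \<longrightarrow> E y w) \<and>
      (\<forall>y\<in>el a. \<forall>z\<in>el a. E y z \<or> y = z \<or> E z y)"
    using assms unfolding is_ordinal_def by (elim conjE) (intro conjI)
  with 4 show ?thesis
    unfolding wo_def by (elim conjE) (intro conjI)
qed

lemma el_ordinal_subset:
  assumes "is_ordinal M E a" "b \<in> el a"
  shows "el b \<subseteq> el a"
  using assms(1)[unfolded is_ordinal_def, THEN conjunct2, THEN conjunct1] assms(2) by blast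

lemma is_ordinalI:
  assumes "a \<in> M" "\<And>y. y \<in> el a \<Longrightarrow> el y \<subseteq> el a" "wo (el a) E"
  shows "is_ordinal M E a"
proof -
  have "\<exists>y\<in>el z. \<forall>w\<in>el z. y = w \<or> E y w" if "z \<in> M" "el z \<subseteq> el a \<and> el z \<noteq> {}" for z
    using wo_least[OF assms(3) small_el[OF that(1)] conjunct1[OF that(2)] conjunct2[OF that(2)]] by metis
  note least = this
  show ?thesis
    unfolding is_ordinal_def
  proof (intro conjI ballI impI)
    show "a \<in> M" by fact
    show "el y \<subseteq> el a" if "y \<in> el a" for y by (rule assms(2)[OF that])
    show "\<not> E y y" if "y \<in> el a" for y by (rule wo_irrefl[OF assms(3) that])
    show "E y w" if "y \<in> el a" "z \<in> el a" "w \<in> el a" "E y z" "E z w" for y z w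
      by (rule wo_trans[OF assms(3) that])
    show "E y z \<or> y = z \<or> E z y" if "y \<in> el a" "z \<in> el a" for y z
      by (rule wo_linear[OF assms(3) that])
    show "\<exists>y\<in>el z. \<forall>w\<in>el z. y = w \<or> E y w" if "z \<in> M" "el z \<subseteq> el a \<and> el z \<noteq> {}" for z
      by (rule least[OF that])
  qed
qed

lemma el_ordinal:
  assumes a: "is_ordinal M E a" and b: "b \<in> el a"
  shows "is_ordinal M E b"
proof -
  have sub: "el b \<subseteq> el a" by (rule el_ordinal_subset[OF a b])
  have "el y \<subseteq> el b" if y: "y \<in> el b" for y
  proof
    fix w assume w: "w \<in> el y"
    have "y \<in> el a" using y sub by blast
    then have "w \<in> el a" using w el_ordinal_subset[OF a] by blast
    then have "E w b"
      using wo_trans[OF is_ordinal_wo[OF a] _ \<open>y \<in> el a\<close> b] w y by (simp add: el_iff)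
    then show "w \<in> el b" using w by (simp add: el_iff)
  qed
  then show ?thesis
    by (rule is_ordinalI[OF el_M[OF b] _ wo_subset[OF is_ordinal_wo[OF a] sub]])
qed

lemma is_cardinal_ordinal: "is_cardinal M E a \<Longrightarrow> is_ordinal M E a"
  by (simp add: is_cardinal_def)

text \<open>The definition of a cardinal excludes only bijections; the Cantor--Bernstein argument
  extends this to injections.\<close>

lemma cardinal_no_inj:
  assumes a: "is_cardinal M E a" and b: "b \<in> el a"
    and F: "sfun (el a) F" "inj_on F (el a)" "F ` el a \<subseteq> el b"
  shows False
proof -
  note o = is_cardinal_ordinal[OF a]
  have "\<exists>H. sfun (el a) H \<and> bij_betw H (el a) (el b)"
    by (rule bij_of_inj_into_subset[OF F el_ordinal_subset[OF o b] small_el[OF el_M[OF b]]])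
  then have "\<exists>f\<in>M. is_bijection M E f a b"
    using bijection_iff[OF is_ordinal_in_M[OF o] el_M[OF b]] by blast
  then show False using a b by (auto simp: is_cardinal_def)
qed

lemma dfn_is_bijection:
  assumes "tm t" "tm u" "tm v"
  shows "dfn (\<lambda>s. is_bijection M E (t s) (u s) (v s))"
proof (rule dfn_subst3[OF _ assms])
  have "dfn (\<lambda>s. (\<forall>p\<in>el (s 0). \<exists>x\<in>el (s 1). \<exists>y\<in>el (s 2). is_opair M E p x y) \<and>
     (\<forall>x\<in>el (s 1). \<exists>y\<in>el (s 2). maps_to M E (s 0) x y \<and>
        (\<forall>y'\<in>el (s 2). maps_to M E (s 0) x y' \<longrightarrow> y' = y)) \<and>
     (\<forall>y\<in>el (s 2). \<exists>x\<in>el (s 1). maps_to M E (s 0) x y \<and>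
        (\<forall>x'\<in>el (s 1). maps_to M E (s 0) x' y \<longrightarrow> x' = x)))" (is "dfn ?P")
    by (intro dfn_basic dfn_is_opair dfn_maps_to)
  then show "dfn (\<lambda>s. is_bijection M E (s 0) (s 1) (s 2))"
  proof (rule dfn_cong)
    fix s :: "nat \<Rightarrow> 'v" assume "range s \<subseteq> M"
    then have "s 0 \<in> M" by auto
    then show "?P s = is_bijection M E (s 0) (s 1) (s 2)"
      unfolding is_bijection_def is_function_def Ex1_def Bex_def Ball_def by simp meson
  qed
qed

text \<open>The least \<open>c\<close> in \<open>l\<close> equinumerous with \<open>a\<close> is a
  cardinal, since an ordinal below \<open>c\<close> equinumerous with \<open>c\<close> would be
  equinumerous with \<open>a\<close> too. The ordinal \<open>l\<close> confines the search to a
  set.\<close>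

lemma cardinality_exists:
  assumes l: "is_ordinal M E l" and a: "a \<in> M" and g: "g \<in> el l"
    and F: "sfun (el a) F" "bij_betw F (el a) (el g)"
  shows "\<exists>c\<in>el l. is_card_of M E a c"
proof -
  let ?Z = "{c \<in> el l. \<exists>f\<in>M. is_bijection M E f a c}"
  have Z: "small ?Z" "?Z \<subseteq> el l"
    by (intro small_sep small_el is_ordinal_in_M[OF l] dfn_basic dfn_is_bijection a) blast
  have "?Z \<noteq> {}" using bijection_iff[OF a el_M[OF g]] F g by blast
  from wo_least[OF is_ordinal_wo[OF l] Z this] obtain c
    where c: "c \<in> ?Z" "\<forall>z\<in>?Z. c = z \<or> E c z" by (elim bexE)
  then obtain H where H: "sfun (el a) H" "bij_betw H (el a) (el c)"
    using bijection_iff[OF a el_M[of c l]] by blast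
  have cl: "c \<in> el l" using c by blast
  have "\<not> (\<exists>f\<in>M. is_bijection M E f c y)" if y: "y \<in> el c" for y
  proof
    assume "\<exists>f\<in>M. is_bijection M E f c y"
    then obtain G where G: "sfun (el c) G" "bij_betw G (el c) (el y)"
      using bijection_iff[OF el_M[OF cl] el_M[OF y]] by blast
    have "sfun (el a) (\<lambda>x. G (H x))" using H(2) by (intro sfun_comp[OF H(1) G(1)]) (auto simp: bij_betw_def)
    moreover have "bij_betw (\<lambda>x. G (H x)) (el a) (el y)" using bij_betw_trans[OF H(2) G(2)] by (simp add: o_def)
    ultimately have "\<exists>f\<in>M. is_bijection M E f a y" using bijection_iff[OF a el_M[OF y]] by blast
    moreover have yl: "y \<in> el l" using el_ordinal_subset[OF l cl] y by blast
    ultimately have "c = y \<or> E c y" using c(2) by blast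
    moreover have "E y c" using y by (simp add: el_iff)
    ultimately show False
      using wo_irrefl[OF is_ordinal_wo[OF l] cl] wo_asym[OF is_ordinal_wo[OF l] cl yl] by blast
  qed
  then have "is_cardinal M E c" using el_ordinal[OF l cl] by (simp add: is_cardinal_def)
  then show ?thesis using c by (auto simp: is_card_of_def)
qed

text \<open>The cardinality of \<open>b\<close> is a cardinal below \<open>l\<close>, and
  \<open>l\<close> is the least cardinal above \<open>k\<close>; so it is at most
  \<open>k\<close>.\<close>

lemma inj_below_succ_cardinal:
  assumes l: "is_succ_cardinal M E k l" and k: "k \<in> M" and b: "b \<in> el l"
  shows "\<exists>F. sfun (el b) F \<and> inj_on F (el b) \<and> F ` el b \<subseteq> el k"
proof -
  have lo: "is_ordinal M E l" and kl: "k \<in> el l"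
    using l k by (auto simp: is_succ_cardinal_def is_cardinal_def el_iff)
  have "sfun (el b) (\<lambda>x. x)" by (rule sfun_id[OF small_el[OF el_M[OF b]]])
  then obtain c where c: "c \<in> el l" "is_card_of M E b c"
    using cardinality_exists[OF lo el_M[OF b] b _ bij_betw_id[unfolded id_def]] by blast
  then obtain F where F: "sfun (el b) F" "bij_betw F (el b) (el c)"
    using bijection_iff[OF el_M[OF b] el_M[OF c(1)]] by (auto simp: is_card_of_def)
  have "\<not> E k c"
  proof
    assume "E k c"
    then have "l = c \<or> E l c"
      using l c el_M[OF c(1)] by (auto simp: is_succ_cardinal_def is_card_of_def)
    moreover have "E c l" "\<not> E c c" using c(1) wo_irrefl[OF is_ordinal_wo[OF lo] c(1)] by (auto simp: el_iff)
    moreover have "\<not> E l c"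
    proof
      assume "E l c"
      then have "l \<in> el l" using el_ordinal_subset[OF lo c(1)] is_ordinal_in_M[OF lo] by (auto simp: el_iff)
      then show False using wo_irrefl[OF is_ordinal_wo[OF lo], of l] by (simp add: el_iff)
    qed
    ultimately show False by blast
  qed
  then have "c = k \<or> c \<in> el k"
    using wo_linear[OF is_ordinal_wo[OF lo] kl c(1)] el_M[OF c(1)] by (auto simp: el_iff)
  then have "el c \<subseteq> el k" using el_ordinal_subset[OF el_ordinal[OF lo kl]] by blast
  then show ?thesis using F by (auto simp: bij_betw_def)
qed

section \<open>Regular cardinals and their pairing functions\<close>

text \<open>A map that is not cofinal leaves some \<open>d\<close> undominated, and by linearity
  \<open>d\<close> is a strict bound.\<close>

lemma bounded_if_no_cofinal_map:
  assumes k: "is_ordinal M E k" and c: "c \<in> el k" and e: "e \<in> M" "\<not> has_cofinal_map M E e k"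
    and F: "sfun I F" "I \<subseteq> el e" "F ` I \<subseteq> el k"
  shows "\<exists>d\<in>el k. \<forall>i\<in>I. E (F i) d"
proof -
  note kM = is_ordinal_in_M[OF k]
  \<comment> \<open>\<open>has_cofinal_map\<close> speaks of total maps on \<open>e\<close>, so the
    partial map is filled up with the default \<open>c\<close>.\<close>
  define G where "G i = (if i \<in> I then F i else c)" for i
  have "sfun (el e) G"
  proof (rule sfunI[OF small_el[OF e(1)] small_el[OF kM]])
    show "dfn (\<lambda>s. s 0 \<in> I \<and> (s 0, s 1) \<in> gr I F \<or> s 0 \<notin> I \<and> s 1 = c)"
      by (intro dfn_basic dfn_gr F cls_small sfun_small[OF F(1)] el_M[OF c])
    show "G x \<in> el k" if "x \<in> el e" for x using F(3) c by (auto simp: G_def)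
    show "(x \<in> I \<and> (x, y) \<in> gr I F \<or> x \<notin> I \<and> y = c) \<longleftrightarrow> y = G x" for x y
      by (simp add: G_def gr_iff)
  qed
  moreover have G: "G ` el e \<subseteq> el k" using F(3) c by (auto simp: G_def)
  ultimately obtain f where f: "f \<in> M" "is_function M E f e k"
      "\<forall>x y. maps_to M E f x y \<longleftrightarrow> x \<in> el e \<and> y = G x"
    using is_functionI[OF e(1) kM] by blast
  then obtain d where d: "d \<in> el k" "\<And>i y. i \<in> el e \<Longrightarrow> y \<in> el k \<Longrightarrow> maps_to M E f i y \<Longrightarrow> \<not> (d = y \<or> E d y)"
    using e(2) unfolding has_cofinal_map_def by blast
  have "E (F i) d" if i: "i \<in> I" for i
  proof -
    have m: "F i \<in> el k" "i \<in> el e" using F i by auto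
    have "maps_to M E f i (F i)" using f(3) i m by (simp add: G_def)
    from d(2)[OF m(2,1) this] show ?thesis using wo_linear[OF is_ordinal_wo[OF k] d(1) m(1)] by blast
  qed
  then show ?thesis using d(1) by blast
qed

lemma is_regular_ordinal: "is_regular_cardinal M E k \<Longrightarrow> is_ordinal M E k"
  by (simp add: is_regular_cardinal_def is_infinite_cardinal_def is_cardinal_def)

lemma regular_bounded:
  assumes k: "is_regular_cardinal M E k" and e: "e \<in> el k"
    and F: "sfun I F" "I \<subseteq> el e" "F ` I \<subseteq> el k"
  shows "\<exists>d\<in>el k. \<forall>i\<in>I. E (F i) d"
  using k e by (intro bounded_if_no_cofinal_map[OF is_regular_ordinal[OF k] e el_M[OF e] _ F])
    (auto simp: is_regular_cardinal_def is_cof_def)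

text \<open>If \<open>x\<close> were the last element of \<open>k\<close>, the constant map with
  value \<open>x\<close> on a nonempty \<open>z\<close> in \<open>k\<close> would be cofinal. The
  limit ordinal \<open>w\<close>, which is at most \<open>k\<close>, supplies such a
  \<open>z\<close>.\<close>

lemma regular_limit:
  assumes k: "is_regular_cardinal M E k" and x: "x \<in> el k"
  shows "\<exists>y\<in>el k. E x y"
proof (rule ccontr)
  assume n: "\<not> (\<exists>y\<in>el k. E x y)"
  note ko = is_regular_ordinal[OF k]
  obtain w where w: "w \<in> M" "is_omega M E w" "w = k \<or> E w k"
    using k by (auto simp: is_regular_cardinal_def is_infinite_cardinal_def)
  have wk: "el w \<subseteq> el k" using w el_ordinal_subset[OF ko, of w] by (auto simp: el_iff)
  obtain y z where yz: "y \<in> el w" "z \<in> el w" "E y z"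
    using w(2) unfolding is_omega_def is_limit_def by blast
  then have z: "z \<in> el k" "y \<in> el z" using wk by (auto simp: el_iff)
  have "sfun (el z) (\<lambda>_. x)" by (rule sfun_const[OF small_el[OF el_M[OF z(1)]] el_M[OF x]])
  moreover have "(\<lambda>_. x) ` el z \<subseteq> el k" using x by auto
  ultimately obtain f where f: "f \<in> M" "is_function M E f z k"
      "\<forall>u v. maps_to M E f u v \<longleftrightarrow> u \<in> el z \<and> v = x"
    using is_functionI[OF el_M[OF z(1)] is_ordinal_in_M[OF ko]] by blast
  have "u = x \<or> E u x" if "u \<in> el k" for u
    using n that wo_linear[OF is_ordinal_wo[OF ko] that x] by blast
  then have "has_cofinal_map M E z k"
    unfolding has_cofinal_map_def using f z(2) x by blast
  then show False using k z(1) by (auto simp: is_regular_cardinal_def is_cof_def)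
qed

text \<open>Regularity is used twice: the preimages of row \<open>i\<close> are bounded by some
  \<open>D i\<close>, and all the \<open>D i\<close> are bounded by some \<open>d\<close>. But
  \<open>H d\<close> lies in some row \<open>i\<close>, which puts \<open>d\<close> below
  \<open>D i\<close> and \<open>D i\<close> below \<open>d\<close>.\<close>

lemma regular_no_inj_into_square:
  assumes k: "is_regular_cardinal M E k" and m: "m \<in> el k"
    and H: "sfun (el k) H" "inj_on H (el k)" "H ` el k \<subseteq> prods (el m) (el m)"
  shows False
proof -
  note ko = is_regular_ordinal[OF k]
  have sm: "small (el m)" "small (el k)" using el_M[OF m] is_ordinal_in_M[OF ko] by (auto intro: small_el)
  \<comment> \<open>The coordinates of \<open>H x\<close> in relational form, because the calculus
    has no function terms.\<close>
  define K where "K x i j \<longleftrightarrow> (\<exists>q\<in>prods (el m) (el m). is_opair M E q i j \<and> (x, q) \<in> gr (el k) H)"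
    for x i j
  have dK: "dfn (\<lambda>s. K (t s) (u s) (v s))" if "tm t" "tm u" "tm v" for t u v
    by (rule dfn_subst3[OF _ that])
      (unfold K_def, intro dfn_basic dfn_is_opair dfn_gr H cls_small small_prods sm)
  have K_iff: "K x i j \<longleftrightarrow> H x = opr i j" if "x \<in> el k" "i \<in> el m" "j \<in> el m" for x i j
  proof -
    have "is_opair M E q i j \<longleftrightarrow> q = opr i j" if "q \<in> prods (el m) (el m)" for q
      using is_opair_iff[OF prods_M[OF sm(1,1) that]] el_M[OF \<open>i \<in> el m\<close>] el_M[OF \<open>j \<in> el m\<close>] by simp
    then show ?thesis unfolding K_def gr_iff using H(3) that by auto
  qed
  define R where "R i d \<longleftrightarrow> (\<forall>x\<in>el k. \<forall>j\<in>el m. K x i j \<longrightarrow> E x d)" for i d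
  have dR: "dfn (\<lambda>s. R (s 0) (s 1))"
    unfolding R_def by (intro dfn_basic dK cls_small sm)
  have R_iff: "R i d \<longleftrightarrow> (\<forall>x\<in>el k. \<forall>j\<in>el m. H x = opr i j \<longrightarrow> E x d)" if "i \<in> el m" for i d
    using that by (simp add: R_def K_iff)
  have "\<exists>d\<in>el k. R i d" if i: "i \<in> el m" for i
  proof -
    \<comment> \<open>The columns that \<open>H\<close> hits in row \<open>i\<close>;
      \<open>B\<close> sends each of them to its preimage and is thus a partial map from
      \<open>m\<close> to \<open>k\<close>.\<close>
    define I where "I = {j \<in> el m. \<exists>x\<in>el k. K x i j}"
    have I_iff: "j \<in> I \<longleftrightarrow> j \<in> el m \<and> (\<exists>x\<in>el k. H x = opr i j)" for j
      unfolding I_def using i by (auto simp: K_iff)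
    define B where "B j = inv_into (el k) H (opr i j)" for j
    have B: "B j \<in> el k" "H (B j) = opr i j" if "j \<in> I" for j
    proof -
      have "opr i j \<in> H ` el k" using that I_iff by force
      then show "B j \<in> el k" "H (B j) = opr i j" unfolding B_def by (auto intro: inv_into_into f_inv_into_f)
    qed
    have "small I" unfolding I_def
      by (intro small_sep sm dfn_basic dK cls_small el_M[OF i])
    then have "sfun I B"
    proof (rule sfunI[OF _ sm(2)])
      show "dfn (\<lambda>s. K (s 1) i (s 0))" by (intro dK tm_var tm_const el_M[OF i])
      fix j x assume j: "j \<in> I" and x: "x \<in> el k"
      have "j \<in> el m" using j I_iff by blast
      then have "K x i j \<longleftrightarrow> H x = opr i j" by (rule K_iff[OF x i])
      also have "\<dots> \<longleftrightarrow> x = B j" using B[OF j] inj_onD[OF H(2) _ x B(1)[OF j]] by auto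
      finally show "K x i j \<longleftrightarrow> x = B j" .
    qed (use B in blast)
    moreover have "I \<subseteq> el m" "B ` I \<subseteq> el k" using B by (auto simp: I_def)
    ultimately obtain d where d: "d \<in> el k" "\<forall>j\<in>I. E (B j) d" using regular_bounded[OF k m] by blast
    have "E x d" if x: "x \<in> el k" "j \<in> el m" "H x = opr i j" for x j
    proof -
      have "j \<in> I" using x I_iff by blast
      then have "B j = x" using B[of j] inj_onD[OF H(2), of "B j" x] x by simp
      then show ?thesis using d(2) \<open>j \<in> I\<close> by blast
    qed
    then show ?thesis using d(1) R_iff[OF i] by blast
  qed
  from choice_function[OF sm dR this] obtain D where
    D: "sfun (el m) D" "\<forall>i\<in>el m. D i \<in> el k \<and> R i (D i)" by blast
  then obtain d where d: "d \<in> el k" "\<forall>i\<in>el m. E (D i) d"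
    using regular_bounded[OF k m D(1)] by blast
  have "H d \<in> prods (el m) (el m)" using H(3) d(1) by blast
  then obtain i j where ij: "i \<in> el m" "j \<in> el m" "H d = opr i j" by (auto simp: prods_def)
  then have "E d (D i)" using D(2) R_iff d(1) by blast
  moreover have "E (D i) d" "D i \<in> el k" using d D ij by auto
  ultimately show False using wo_asym[OF is_ordinal_wo[OF ko], of d "D i"] d(1) by blast
qed

text \<open>Goedel's order of pairs: every proper initial segment lies in some \<open>m \<times> m\<close> with \<open>m < k\<close>,
  so \<open>k\<close> does not embed in it.\<close>

lemma regular_pairing:
  assumes k: "is_regular_cardinal M E k"
  shows "\<exists>p. sfun (prods (el k) (el k)) p \<and> inj_on p (prods (el k) (el k)) \<and>
    p ` prods (el k) (el k) \<subseteq> el k"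
proof -
  note ko = is_regular_ordinal[OF k]
  note wk = is_ordinal_wo[OF ko]
  have sk: "small (el k)" by (rule small_el[OF is_ordinal_in_M[OF ko]])
  let ?S = "prods (el k) (el k)"
  have sS: "small ?S" by (rule small_prods[OF sk sk])
  define mx where "mx i j = (if E i j then j else i)" for i j
  have mx: "mx i j \<in> el k" if "i \<in> el k" "j \<in> el k" for i j using that by (simp add: mx_def)
  \<comment> \<open>Decomposes \<open>q\<close> into its coordinates and their maximum
    \<open>m\<close>, again in relational form.\<close>
  define T where "T q m i j \<longleftrightarrow> is_opair M E q i j \<and> (E i j \<and> m = j \<or> \<not> E i j \<and> m = i)" for q m i j
  have T_iff: "T (opr i j) m i' j' \<longleftrightarrow> i' = i \<and> j' = j \<and> m = mx i j"
    if "i \<in> el k" "j \<in> el k" for m i j i' j'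
  proof -
    have "is_opair M E (opr i j) i' j' \<longleftrightarrow> i' = i \<and> j' = j"
      using is_opair_iff[OF opr_in_M[of i j]] opr_inject[of i j i' j'] el_M[OF that(1)] el_M[OF that(2)] by auto
    then show ?thesis unfolding T_def mx_def by auto
  qed
  define L where "L m i j m' i' j' \<longleftrightarrow> E m m' \<or> m = m' \<and> (E i i' \<or> i = i' \<and> E j j')" for m i j m' i' j'
  define R where "R q q' \<longleftrightarrow> (\<exists>m\<in>el k. \<exists>i\<in>el k. \<exists>j\<in>el k. \<exists>m'\<in>el k. \<exists>i'\<in>el k. \<exists>j'\<in>el k.
      T q m i j \<and> T q' m' i' j' \<and> L m i j m' i' j')" for q q'
  have dT: "dfn (\<lambda>s. T (t s) (u s) (v s) (w s))" if "tm t" "tm u" "tm v" "tm w" for t u v w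
    unfolding T_def by (intro dfn_basic dfn_is_opair that)
  have dR: "dfn (\<lambda>s. R (s 0) (s 1))"
    unfolding R_def L_def by (intro dfn_basic dT cls_small sk)
  have R_iff: "R (opr i j) (opr i' j') \<longleftrightarrow> L (mx i j) i j (mx i' j') i' j'"
    if "i \<in> el k" "j \<in> el k" "i' \<in> el k" "j' \<in> el k" for i j i' j'
    unfolding R_def T_iff[OF that(1,2)] T_iff[OF that(3,4)] using that mx by auto
  have irr: "\<not> E x x" if "x \<in> el k" for x using wo_irrefl[OF wk that] .
  have tr: "E x z" if "E x y" "E y z" "x \<in> el k" "y \<in> el k" "z \<in> el k" for x y z
    using wo_trans[OF wk that(3,4,5,1,2)] .
  have lin: "E x y \<or> x = y \<or> E y x" if "x \<in> el k" "y \<in> el k" for x y using wo_linear[OF wk that] .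
  have woR: "wo ?S R"
    unfolding wo_def
  proof (intro conjI ballI impI allI)
    fix x assume "x \<in> ?S"
    then obtain i j where x: "i \<in> el k" "j \<in> el k" "x = opr i j" by (auto simp: prods_def)
    show "\<not> R x x" unfolding x(3) R_iff[OF x(1,2,1,2)] L_def using irr x mx by blast
    fix y assume "y \<in> ?S"
    then obtain i' j' where y: "i' \<in> el k" "j' \<in> el k" "y = opr i' j'" by (auto simp: prods_def)
    show "R x y \<or> x = y \<or> R y x"
      unfolding x(3) y(3) R_iff[OF x(1,2) y(1,2)] R_iff[OF y(1,2) x(1,2)] L_def
      using lin[OF mx[OF x(1,2)] mx[OF y(1,2)]] lin[OF x(1) y(1)] lin[OF x(2) y(2)] by metis
    fix z assume "z \<in> ?S" and R: "R x y" "R y z"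
    then obtain i'' j'' where z: "i'' \<in> el k" "j'' \<in> el k" "z = opr i'' j''" by (auto simp: prods_def)
    show "R x z"
      using R unfolding x(3) y(3) z(3) R_iff[OF x(1,2) y(1,2)] R_iff[OF y(1,2) z(1,2)] R_iff[OF x(1,2) z(1,2)] L_def
      using tr[OF _ _ mx[OF x(1,2)] mx[OF y(1,2)] mx[OF z(1,2)]] tr[OF _ _ x(1) y(1) z(1)]
        tr[OF _ _ x(2) y(2) z(2)] by metis
  next
    fix Z assume Z: "small Z \<and> Z \<subseteq> ?S \<and> Z \<noteq> {}"
    \<comment> \<open>The least pair is found by minimising the maximum, then the first coordinate
      among the pairs left, then the second.\<close>
    let ?Z1 = "{m \<in> el k. \<exists>q\<in>Z. \<exists>i\<in>el k. \<exists>j\<in>el k. T q m i j}"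
    have s1: "small ?Z1" "?Z1 \<subseteq> el k" using Z by (intro small_sep sk dfn_basic dT cls_small) auto
    have Zel: "\<exists>i\<in>el k. \<exists>j\<in>el k. q = opr i j" if "q \<in> Z" for q using that Z by (auto simp: prods_def)
    obtain q i0 j0 where "q \<in> Z" "i0 \<in> el k" "j0 \<in> el k" "q = opr i0 j0" using Z Zel by blast
    then have "mx i0 j0 \<in> ?Z1" using T_iff mx by blast
    then have "?Z1 \<noteq> {}" by blast
    from wo_least[OF wk s1 this] obtain m where m: "m \<in> ?Z1" "\<forall>z\<in>?Z1. m = z \<or> E m z" by (elim bexE)
    then have mk: "m \<in> el k" by blast
    let ?Z2 = "{i \<in> el k. \<exists>q\<in>Z. \<exists>j\<in>el k. T q m i j}"
    have s2: "small ?Z2" "?Z2 \<subseteq> el k" using Z by (intro small_sep sk dfn_basic dT cls_small el_M[OF mk]) auto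
    have "?Z2 \<noteq> {}" using m by blast
    from wo_least[OF wk s2 this] obtain i where i: "i \<in> ?Z2" "\<forall>z\<in>?Z2. i = z \<or> E i z" by (elim bexE)
    then have ik: "i \<in> el k" by blast
    let ?Z3 = "{j \<in> el k. \<exists>q\<in>Z. T q m i j}"
    have s3: "small ?Z3" "?Z3 \<subseteq> el k"
      using Z by (intro small_sep sk dfn_basic dT cls_small el_M[OF mk] el_M[OF ik]) auto
    have "?Z3 \<noteq> {}" using i by blast
    from wo_least[OF wk s3 this] obtain j where j: "j \<in> ?Z3" "\<forall>z\<in>?Z3. j = z \<or> E j z" by (elim bexE)
    then obtain q where q: "q \<in> Z" "T q m i j" by blast
    have jk: "j \<in> el k" using j by blast
    obtain a b where ab: "a \<in> el k" "b \<in> el k" "q = opr a b" using Zel[OF q(1)] by blast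
    then have q_eq: "q = opr i j" "m = mx i j" using q(2) T_iff by auto
    have "q = z \<or> R q z" if z: "z \<in> Z" for z
    proof -
      obtain i' j' where z': "i' \<in> el k" "j' \<in> el k" "z = opr i' j'" using Zel[OF z] by blast
      have Tz: "T z (mx i' j') i' j'" using z' T_iff by blast
      have 1: "m = mx i' j' \<or> E m (mx i' j')" using m(2) Tz z z' mx by blast
      have 2: "i = i' \<or> E i i'" if "m = mx i' j'" using i(2) Tz z z' that by blast
      have 3: "j = j' \<or> E j j'" if "m = mx i' j'" "i = i'" using j(2) Tz z z' that by blast
      show ?thesis unfolding q_eq(1) z'(3) R_iff[OF ik jk z'(1,2)] L_def q_eq(2)[symmetric]
        using 1 2 3 by blast
    qed
    then show "\<exists>m\<in>Z. \<forall>z\<in>Z. m = z \<or> R m z" using q(1) by blast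
  qed
  have dE: "dfn (\<lambda>s. E (s 0) (s 1))" by (intro dfn_E tm_var)
  from wo_compare[OF sS sk woR wk dR dE] show ?thesis
  proof (elim disjE)
    assume "\<exists>x\<in>?S. \<exists>H. sfun (el k) H \<and> inj_on H (el k) \<and> H ` el k \<subseteq> {y \<in> ?S. R y x}"
    then obtain x H where x: "x \<in> ?S" and H: "sfun (el k) H" "inj_on H (el k)" "H ` el k \<subseteq> {y \<in> ?S. R y x}" by blast
    obtain i j where ij: "i \<in> el k" "j \<in> el k" "x = opr i j" using x by (auto simp: prods_def)
    \<comment> \<open>\<open>k\<close> is a limit, so \<open>m\<close> can be taken strictly above
      the maximum; both coordinates of every smaller pair then lie in \<open>m\<close>.\<close>
    obtain m where m: "m \<in> el k" "E (mx i j) m" using regular_limit[OF k mx[OF ij(1,2)]] by blast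
    have "{y \<in> ?S. R y x} \<subseteq> prods (el m) (el m)"
    proof
      fix y assume y: "y \<in> {y \<in> ?S. R y x}"
      then obtain i' j' where y': "i' \<in> el k" "j' \<in> el k" "y = opr i' j'" by (auto simp: prods_def)
      have "R y x" using y by blast
      then have "mx i' j' = mx i j \<or> E (mx i' j') (mx i j)"
        unfolding y'(3) ij(3) R_iff[OF y'(1,2) ij(1,2)] L_def by blast
      then have 1: "E (mx i' j') m"
        using m tr[OF _ m(2) mx[OF y'(1,2)] mx[OF ij(1,2)] m(1)] by auto
      have "i' = mx i' j' \<or> E i' (mx i' j')" "j' = mx i' j' \<or> E j' (mx i' j')"
        using lin[OF y'(1,2)] by (auto simp: mx_def)
      then have "E i' m" "E j' m"
        using 1 tr[OF _ 1 y'(1) mx[OF y'(1,2)] m(1)] tr[OF _ 1 y'(2) mx[OF y'(1,2)] m(1)] by auto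
      then show "y \<in> prods (el m) (el m)" using y' el_M by (auto simp: prods_def el_iff)
    qed
    then have "H ` el k \<subseteq> prods (el m) (el m)" using H(3) by (rule order_trans[rotated])
    then show ?thesis using regular_no_inj_into_square[OF k m(1) H(1,2)] by blast
  qed blast
qed


section \<open>Cardinalities of bounded subsets of a cardinal\<close>

text \<open>The comparison maps \<open>a\<close> onto an initial segment of \<open>l\<close>. This
  is not all of \<open>l\<close>, since \<open>l\<close> does not inject into \<open>b\<close>, so
  the image consists of the elements of the least missing ordinal \<open>g\<close>.\<close>

lemma cardinality_below:
  assumes l: "is_cardinal M E l" and b: "b \<in> el l" and a: "a \<in> M" "el a \<subseteq> el b"
  shows "\<exists>c\<in>el l. is_card_of M E a c"
proof -
  note lo = is_cardinal_ordinal[OF l]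
  note wl = is_ordinal_wo[OF lo]
  have al: "el a \<subseteq> el l" using a(2) el_ordinal_subset[OF lo b] by blast
  have dE: "dfn (\<lambda>s. E (s 0) (s 1))" by (intro dfn_E tm_var)
  from wo_compare[OF small_el[OF a(1)] small_el[OF is_ordinal_in_M[OF lo]] wo_subset[OF wl al] wl dE dE]
  show ?thesis
  proof (elim disjE)
    assume "\<exists>H. sfun (el a) H \<and> inj_on H (el a) \<and> H ` el a \<subseteq> el l \<and>
      (\<forall>x\<in>el a. \<forall>y\<in>el l. E y (H x) \<longrightarrow> y \<in> H ` el a)"
    then obtain H where H: "sfun (el a) H" "inj_on H (el a)" "H ` el a \<subseteq> el l"
      "\<forall>x\<in>el a. \<forall>y\<in>el l. E y (H x) \<longrightarrow> y \<in> H ` el a" by blast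
    have sm: "small (el l - H ` el a)"
      by (intro small_Diff small_el is_ordinal_in_M[OF lo] sfun_image[OF H(1)])
    have "el l - H ` el a \<noteq> {}"
    proof
      assume "el l - H ` el a = {}"
      then have eq: "H ` el a = el l" using H(3) by blast
      have "inv_into (el a) H ` el l \<subseteq> el b" using inv_into_into[of _ H "el a"] a(2) eq by blast
      moreover have "sfun (el l) (inv_into (el a) H)" using sfun_inv[OF H(1,2)] eq by simp
      moreover have "inj_on (inv_into (el a) H) (el l)" using inj_on_inv_into[of "el l" H "el a"] eq by simp
      ultimately show False using cardinal_no_inj[OF l b] by blast
    qed
    from wo_least[OF wl sm Diff_subset this] obtain g
      where g: "g \<in> el l - H ` el a" "\<forall>z\<in>el l - H ` el a. g = z \<or> E g z" by (elim bexE)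
    have gl: "g \<in> el l" using g(1) by blast
    have "H ` el a = el g"
    proof (intro equalityI subsetI)
      fix y assume y: "y \<in> H ` el a"
      then have yl: "y \<in> el l" using H(3) by blast
      have "\<not> E g y" using y H(4) g(1) by blast
      moreover have "y \<noteq> g" using y g(1) by blast
      ultimately have "E y g" using wo_linear[OF wl yl gl] by blast
      then show "y \<in> el g" using el_M[OF yl] by (simp add: el_iff)
    next
      fix y assume y: "y \<in> el g"
      then have yl: "y \<in> el l" using el_ordinal_subset[OF lo gl] by blast
      have yg: "E y g" using y by (simp add: el_iff)
      show "y \<in> H ` el a"
      proof (rule ccontr)
        assume "y \<notin> H ` el a"
        then have "g = y \<or> E g y" using g(2) yl by blast
        then show False using yg wo_irrefl[OF wl gl] wo_asym[OF wl gl yl] by blast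
      qed
    qed
    then have "bij_betw H (el a) (el g)" using H(2) by (simp add: bij_betw_def)
    then show ?thesis by (rule cardinality_exists[OF lo a(1) gl H(1)])
  next
    assume "\<exists>x\<in>el a. \<exists>H. sfun (el l) H \<and> inj_on H (el l) \<and> H ` el l \<subseteq> {y \<in> el a. E y x}"
    then obtain x H where x: "x \<in> el a" and H: "sfun (el l) H" "inj_on H (el l)"
      "H ` el l \<subseteq> {y \<in> el a. E y x}" by blast
    have "{y \<in> el a. E y x} \<subseteq> el x" using el_M by (auto simp: el_iff)
    then have "H ` el l \<subseteq> el x" using H(3) by blast
    moreover have "x \<in> el l" using x al by blast
    ultimately show ?thesis using cardinal_no_inj[OF l _ H(1,2)] by blast
  qed
qed

end

section \<open>Transitive inner models\<close>

text \<open>Both instances share \<open>E\<close>, so every result above is available for the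
  universe under \<open>V\<close> and for the inner model under \<open>N\<close>.\<close>

locale transitive_inner = V: zfc UNIV E + N: zfc W E
  for E :: "'v \<Rightarrow> 'v \<Rightarrow> bool" and W :: "'v set" +
  assumes transitive: "x \<in> W \<Longrightarrow> E y x \<Longrightarrow> y \<in> W"
    and class_W: "V.cls W"
begin

lemma el_eq: "x \<in> W \<Longrightarrow> N.el x = V.el x"
  using transitive by (auto simp: elts_def)

lemma small_up: "N.small S \<Longrightarrow> V.small S"
  unfolding N.small_def V.small_def using el_eq by blast

lemma st_eq: "N.small S \<Longrightarrow> N.st S = V.st S"
  by (rule V.el_ext) (simp_all add: N.st V.st small_up el_eq[symmetric])

lemma opr_eq: "x \<in> W \<Longrightarrow> y \<in> W \<Longrightarrow> N.opr x y = V.opr x y"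
  unfolding N.opr_def V.opr_def
  using N.small_singleton[of x] N.small_pair[of x y] N.st_in_M[of "{x}"] N.st_in_M[of "{x, y}"]
    N.small_pair[of "N.st {x}" "N.st {x, y}"] by (simp add: st_eq)

lemma opr_in_W: "V.opr x y \<in> W \<Longrightarrow> x \<in> W \<and> y \<in> W"
proof -
  assume p: "V.opr x y \<in> W"
  have "E (V.st {x, y}) (V.opr x y)" using V.el_opr[of x y] by (auto simp: elts_def)
  then have "V.st {x, y} \<in> W" using transitive[OF p] by blast
  moreover have "V.el (V.st {x, y}) = {x, y}" by (intro V.el_st V.small_pair) auto
  ultimately show ?thesis using transitive by (auto simp: elts_def)
qed

text \<open>Elements of a set in \<open>W\<close> are in \<open>W\<close>, and so are the
  coordinates of a pair in \<open>W\<close>. Hence codes of functions in \<open>W\<close> are read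
  alike in both models.\<close>

lemma maps_to_eq:
  assumes "f \<in> W"
  shows "maps_to W E f x y \<longleftrightarrow> maps_to UNIV E f x y"
proof -
  have "V.opr x y \<in> W" if "V.opr x y \<in> V.el f"
    using that transitive[OF assms] by (simp add: elts_def)
  then show ?thesis
    unfolding N.maps_to_iff V.maps_to_iff el_eq[OF assms] using opr_eq[of x y] opr_in_W[of x y] by auto
qed

lemma prods_eq:
  assumes "S \<subseteq> W" "T \<subseteq> W"
  shows "N.prods S T = V.prods S T"
proof -
  have "N.opr x y = V.opr x y" if "x \<in> S" "y \<in> T" for x y
    using that assms by (intro opr_eq) auto
  then show ?thesis unfolding N.prods_def V.prods_def by (intro Collect_cong) metis
qed

lemma smallrel_up:
  assumes "N.smallrel r"
  shows "V.smallrel r"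
proof -
  obtain S T where ST: "N.small S" "N.small T" "r \<subseteq> S \<times> T" "N.small ((\<lambda>(x, y). N.opr x y) ` r)"
    using assms by (auto simp: N.smallrel_def)
  have "(\<lambda>(x, y). N.opr x y) ` r = (\<lambda>(x, y). V.opr x y) ` r"
    using ST(3) N.small_subset_M[OF ST(1)] N.small_subset_M[OF ST(2)]
    by (intro image_cong refl) (auto intro!: opr_eq)
  then show ?thesis
    unfolding V.smallrel_def using ST small_up by metis
qed

text \<open>Functions pass from \<open>W\<close> to the universe but not back. The argument rests on
  this asymmetry: the cofinal map below exists only in the universe.\<close>

lemma sfun_up: "N.sfun S F \<Longrightarrow> V.sfun S F"
  unfolding N.sfun_def V.sfun_def by (simp add: small_up smallrel_up)

end

section \<open>The situation to be refuted\<close>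

text \<open>The hypotheses of the theorem without the covering property, together with the negated
  conclusion \<open>cof_k\<close>.\<close>

locale singularized_cardinal = transitive_inner E W
  for E :: "'v \<Rightarrow> 'v \<Rightarrow> bool" and W :: "'v set" +
  fixes k l th :: 'v
  assumes k_card: "is_cardinal UNIV E k"
    and th_reg: "is_regular_cardinal UNIV E th"
    and th_k: "E th k"
    and l_succ: "is_succ_cardinal UNIV E k l"
    and k_reg_W: "is_regular_cardinal W E k"
    and l_succ_W: "is_succ_cardinal W E k l"
    and cof_k: "is_cof UNIV E k th"
begin

abbreviation "el \<equiv> V.el"
abbreviation "mp \<equiv> maps_to UNIV E"

lemma k_ord: "is_ordinal UNIV E k"
  using k_card by (simp add: is_cardinal_def)

lemma l_card: "is_cardinal UNIV E l"
  using l_succ by (simp add: is_succ_cardinal_def)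

lemma l_ord: "is_ordinal UNIV E l"
  using l_card by (simp add: is_cardinal_def)

lemma th_ord: "is_ordinal UNIV E th"
  by (rule V.is_regular_ordinal[OF th_reg])

lemma wo_k: "V.wo (el k) E" and wo_l: "V.wo (el l) E" and wo_th: "V.wo (el th) E"
  by (rule V.is_ordinal_wo[OF k_ord] V.is_ordinal_wo[OF l_ord] V.is_ordinal_wo[OF th_ord])+

lemma k_l: "k \<in> el l"
  using l_succ by (simp add: is_succ_cardinal_def elts_def)

lemma th_in_k: "th \<in> el k"
  using th_k by (simp add: elts_def)

lemma k_W: "k \<in> W"
  using k_reg_W N.is_ordinal_in_M N.is_regular_ordinal by blast

lemma l_W: "l \<in> W"
  using l_succ_W N.is_ordinal_in_M N.is_cardinal_ordinal unfolding is_succ_cardinal_def by blast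

lemma el_l_W: "b \<in> el l \<Longrightarrow> b \<in> W"
  using transitive[OF l_W] by (simp add: elts_def)

lemma el_l_trans: "b \<in> el l \<Longrightarrow> x \<in> el b \<Longrightarrow> x \<in> el l"
  using V.el_ordinal_subset[OF l_ord] by blast

lemma el_k_W: "b \<in> el k \<Longrightarrow> b \<in> W"
  using transitive[OF k_W] by (simp add: elts_def)

lemma small_el: "V.small (el a)"
  by (rule V.small_el) simp

lemmas V_dfn = V.dfn_basic V.cls_small small_el UNIV_I

subsection \<open>Injections chosen from the inner model\<close>

text \<open>Collects all candidate codes in one set, as \<open>choice_function\<close> requires a
  codomain fixed in advance.\<close>

definition codes :: "'v set" where
  "codes = {z. el z \<subseteq> V.prods (el l) (el k)}"

text \<open>Only \<open>f \<in> W\<close> refers to the inner model. Definability of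
  \<open>W\<close> is what admits this relation to the axiom of choice of the universe.\<close>

definition inj_code :: "'v \<Rightarrow> 'v \<Rightarrow> bool" where
  "inj_code b f \<longleftrightarrow> f \<in> W \<and> (\<forall>x\<in>el b. \<exists>y\<in>el k. mp f x y) \<and>
     (\<forall>x\<in>el b. \<forall>y\<in>el k. \<forall>y'\<in>el k. mp f x y \<and> mp f x y' \<longrightarrow> y = y') \<and>
     (\<forall>x\<in>el b. \<forall>x'\<in>el b. \<forall>y\<in>el k. mp f x y \<and> mp f x' y \<longrightarrow> x = x')"

lemma small_codes: "V.small codes"
  using V.small_Pow[OF V.small_prods[OF small_el[of l] small_el[of k]]] by (simp add: codes_def)

text \<open>Here the agreement of the two successors of \<open>k\<close> is used: \<open>l\<close>
  is also the successor in \<open>W\<close>, so \<open>W\<close> itself contains an injection of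
  \<open>b\<close> into \<open>k\<close>.\<close>

lemma ex_inj_code:
  assumes b: "b \<in> el l"
  shows "\<exists>f\<in>codes. inj_code b f"
proof -
  have bW: "b \<in> W" by (rule el_l_W[OF b])
  have "b \<in> N.el l" using b by (simp add: el_eq[OF l_W])
  from N.inj_below_succ_cardinal[OF l_succ_W k_W this]
  obtain F where F: "N.sfun (el b) F" "inj_on F (el b)" "F ` el b \<subseteq> el k"
    unfolding el_eq[OF bW] el_eq[OF k_W] by blast
  then obtain f where f: "f \<in> W" "N.el f = (\<lambda>(x, y). N.opr x y) ` N.gr (el b) F"
      "\<forall>x y. maps_to W E f x y \<longleftrightarrow> (x, y) \<in> N.gr (el b) F"
    using N.smallrel_code[of "N.gr (el b) F"] by (auto simp: N.sfun_def)
  have mp: "mp f x y \<longleftrightarrow> x \<in> el b \<and> y = F x" for x y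
    using f(3) maps_to_eq[OF f(1)] by (simp add: N.gr_iff)
  have "el f \<subseteq> V.prods (el l) (el k)"
  proof
    fix p assume "p \<in> el f"
    then have "p \<in> N.el f" by (simp add: el_eq[OF f(1)])
    then obtain x where x: "x \<in> el b" "p = N.opr x (F x)" unfolding f(2) by (auto simp: N.gr_def)
    then have m: "x \<in> el l" "F x \<in> el k" using el_l_trans[OF b] F(3) by auto
    then have "p = V.opr x (F x)" using x(2) opr_eq el_l_W el_k_W by simp
    then show "p \<in> V.prods (el l) (el k)" using m by (auto simp: V.prods_def)
  qed
  moreover have "inj_code b f"
    unfolding inj_code_def mp using f(1) F(2,3) by (auto dest: inj_onD)
  ultimately show ?thesis by (auto simp: codes_def)
qed

text \<open>The choice is made in the universe: every value lies in \<open>W\<close>, but the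
  function as a whole need not.\<close>

definition fc :: "'v \<Rightarrow> 'v" where
  "fc = (SOME F. V.sfun (el l) F \<and> (\<forall>b\<in>el l. F b \<in> codes \<and> inj_code b (F b)))"

lemma fc: "V.sfun (el l) fc \<and> (\<forall>b\<in>el l. fc b \<in> codes \<and> inj_code b (fc b))"
proof -
  have "V.dfn (\<lambda>s. inj_code (s 0) (s 1))"
    unfolding inj_code_def by (intro V_dfn V.dfn_maps_to class_W)
  from someI_ex[OF V.choice_function[OF small_el[of l] small_codes this ex_inj_code]]
  show ?thesis unfolding fc_def by blast
qed

definition phi :: "'v \<Rightarrow> 'v \<Rightarrow> 'v" where
  "phi b x = (THE y. y \<in> el k \<and> mp (fc b) x y)"

lemma phi:
  assumes b: "b \<in> el l" and x: "x \<in> el b"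
  shows phi_in: "phi b x \<in> el k"
    and mp_fc: "y \<in> el k \<Longrightarrow> mp (fc b) x y \<longleftrightarrow> y = phi b x"
proof -
  have i: "inj_code b (fc b)" using fc b by blast
  have ex: "\<exists>y\<in>el k. mp (fc b) x y" using i x by (simp add: inj_code_def)
  have un: "y = y'" if "y \<in> el k" "y' \<in> el k" "mp (fc b) x y" "mp (fc b) x y'" for y y'
  proof -
    have "\<forall>x\<in>el b. \<forall>y\<in>el k. \<forall>y'\<in>el k. mp (fc b) x y \<and> mp (fc b) x y' \<longrightarrow> y = y'"
      using i by (simp add: inj_code_def)
    then show ?thesis using x that by blast
  qed
  have ex1: "\<exists>!y. y \<in> el k \<and> mp (fc b) x y"
    using ex un by blast
  note t = theI'[OF ex1, folded phi_def]
  show "phi b x \<in> el k" using t by blast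
  show "mp (fc b) x y \<longleftrightarrow> y = phi b x" if "y \<in> el k" using t un that by blast
qed

lemma phi_inj:
  assumes b: "b \<in> el l"
  shows "inj_on (phi b) (el b)"
proof (rule inj_onI)
  fix x x' assume x: "x \<in> el b" "x' \<in> el b" "phi b x = phi b x'"
  have "mp (fc b) x (phi b x)" "mp (fc b) x' (phi b x)"
    using mp_fc[OF b x(1) phi_in[OF b x(1)]] mp_fc[OF b x(2) phi_in[OF b x(2)]] x(3) by auto
  moreover have "\<forall>x\<in>el b. \<forall>x'\<in>el b. \<forall>y\<in>el k. mp (fc b) x y \<and> mp (fc b) x' y \<longrightarrow> x = x'"
    using fc b by (simp add: inj_code_def)
  ultimately show "x = x'" using x phi_in[OF b x(1)] by blast
qed

text \<open>A relational form of \<open>phi\<close> with the graph of \<open>fc\<close> as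
  parameter, for use in definability proofs; \<open>Gp\<close> and \<open>Kp\<close> play the same
  part for \<open>G\<close> and \<open>K\<close>.\<close>

definition Ph :: "'v \<Rightarrow> 'v \<Rightarrow> 'v \<Rightarrow> bool" where
  "Ph b x y \<longleftrightarrow> (\<exists>f\<in>codes. (b, f) \<in> V.gr (el l) fc \<and> mp f x y)"

lemma dfn_Ph:
  assumes "V.tm t" "V.tm u" "V.tm v"
  shows "V.dfn (\<lambda>s. Ph (t s) (u s) (v s))"
  by (rule V.dfn_subst3[OF _ assms])
    (unfold Ph_def, intro V_dfn V.dfn_maps_to V.dfn_gr conjunct1[OF fc] small_codes)

lemma Ph_iff: "b \<in> el l \<Longrightarrow> x \<in> el b \<Longrightarrow> y \<in> el k \<Longrightarrow> Ph b x y \<longleftrightarrow> y = phi b x"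
  using mp_fc[of b x y] fc by (auto simp: Ph_def V.gr_iff)

lemma sfun_phi:
  assumes "b \<in> el l"
  shows "V.sfun (el b) (phi b)"
proof (rule V.sfunI[OF small_el small_el[of k]])
  show "V.dfn (\<lambda>s. Ph b (s 0) (s 1))" by (intro dfn_Ph V.tm_var V.tm_const UNIV_I)
qed (use assms in \<open>auto simp: Ph_iff phi_in\<close>)

subsection \<open>A cofinal sequence\<close>

definition g :: "'v \<Rightarrow> 'v" where
  "g = (SOME G. V.sfun (el th) G \<and> G ` el th \<subseteq> el k \<and>
     (\<forall>x\<in>el k. \<exists>i\<in>el th. x = G i \<or> E x (G i)))"

lemma g: "V.sfun (el th) g \<and> g ` el th \<subseteq> el k \<and> (\<forall>x\<in>el k. \<exists>i\<in>el th. x = g i \<or> E x (g i))"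
proof -
  obtain f where f: "is_function UNIV E f th k"
    "\<forall>x\<in>el k. \<exists>i\<in>el th. \<exists>y\<in>el k. mp f i y \<and> (x = y \<or> E x y)"
    using cof_k by (auto simp: is_cof_def has_cofinal_map_def)
  obtain G where G: "V.sfun (el th) G" "G ` el th \<subseteq> el k" "\<And>x y. mp f x y \<longleftrightarrow> x \<in> el th \<and> y = G x"
    using V.is_functionD[OF UNIV_I UNIV_I f(1)] by blast
  have "\<exists>G. V.sfun (el th) G \<and> G ` el th \<subseteq> el k \<and> (\<forall>x\<in>el k. \<exists>i\<in>el th. x = G i \<or> E x (G i))"
    using G(1,2) f(2) unfolding G(3) by blast
  from someI_ex[OF this] show ?thesis unfolding g_def .
qed

definition Gp :: "'v \<Rightarrow> 'v \<Rightarrow> bool" where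
  "Gp a d \<longleftrightarrow> (\<forall>i\<in>el a. \<exists>y\<in>el k. (i, y) \<in> V.gr (el th) g \<and> E y d) \<and>
     (\<forall>d'\<in>el k. (\<forall>i\<in>el a. \<exists>y\<in>el k. (i, y) \<in> V.gr (el th) g \<and> E y d') \<longrightarrow> d = d' \<or> E d d')"

definition G :: "'v \<Rightarrow> 'v" where
  "G a = (THE d. d \<in> el k \<and> Gp a d)"

lemma el_th_subset: "a \<in> el th \<Longrightarrow> el a \<subseteq> el th"
  by (rule V.el_ordinal_subset[OF th_ord])

lemma Gp_iff:
  assumes "a \<in> el th"
  shows "Gp a d \<longleftrightarrow> (\<forall>i\<in>el a. E (g i) d) \<and> (\<forall>d'\<in>el k. (\<forall>i\<in>el a. E (g i) d') \<longrightarrow> d = d' \<or> E d d')"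
proof -
  have "(\<exists>y\<in>el k. (i, y) \<in> V.gr (el th) g \<and> E y d) \<longleftrightarrow> E (g i) d" if "i \<in> el a" for i d
    using that g el_th_subset[OF assms] by (auto simp: V.gr_iff)
  then show ?thesis by (simp add: Gp_def)
qed

lemma dfn_Gp:
  assumes "V.tm t" "V.tm u"
  shows "V.dfn (\<lambda>s. Gp (t s) (u s))"
  by (rule V.dfn_subst2[OF _ assms]) (unfold Gp_def, intro V_dfn V.dfn_gr conjunct1[OF g])

text \<open>\<open>a\<close> is below the cofinality \<open>th\<close>, so \<open>g\<close> is
  bounded on \<open>a\<close> and a least strict bound exists.\<close>

lemma G:
  assumes a: "a \<in> el th"
  shows G_in: "G a \<in> el k" and Gp_G: "d \<in> el k \<Longrightarrow> Gp a d \<longleftrightarrow> d = G a"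
proof -
  let ?Z = "{d \<in> el k. \<forall>i\<in>el a. \<exists>y\<in>el k. (i, y) \<in> V.gr (el th) g \<and> E y d}"
  have eq: "(\<exists>y\<in>el k. (i, y) \<in> V.gr (el th) g \<and> E y d) \<longleftrightarrow> E (g i) d" if "i \<in> el a" for i d
    using that g el_th_subset[OF a] by (auto simp: V.gr_iff)
  have Z: "V.small ?Z" "?Z \<subseteq> el k"
    by (intro V.small_sep small_el V_dfn V.dfn_gr conjunct1[OF g]) blast
  have "V.sfun (el a) g" using V.sfun_subset[OF conjunct1[OF g] small_el el_th_subset[OF a]] .
  moreover have "\<not> has_cofinal_map UNIV E a k" using cof_k a by (simp add: is_cof_def)
  moreover have "g ` el a \<subseteq> el k" using g el_th_subset[OF a] by blast
  \<comment> \<open>\<open>th\<close> is passed as the default value in \<open>k\<close> that the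
    bounding lemma asks for.\<close>
  ultimately have "\<exists>d\<in>el k. \<forall>i\<in>el a. E (g i) d"
    by (intro V.bounded_if_no_cofinal_map[OF k_ord th_in_k UNIV_I]) auto
  then have "?Z \<noteq> {}" using eq by auto
  from V.wo_least[OF wo_k Z this] obtain d where d: "d \<in> ?Z" "\<forall>z\<in>?Z. d = z \<or> E d z" by (elim bexE)
  then have dk: "d \<in> el k" by blast
  have "Gp a d" unfolding Gp_def using d by blast
  moreover have "d' = d" if d': "d' \<in> el k" "Gp a d'" for d'
  proof -
    have "d' = d \<or> E d' d" "d = d' \<or> E d d'"
      using d' dk \<open>Gp a d\<close> unfolding Gp_iff[OF a] by blast+
    then show ?thesis using V.wo_asym[OF wo_k dk d'(1)] by blast
  qed
  ultimately have ex1: "\<exists>!d. d \<in> el k \<and> Gp a d" and *: "\<And>d'. d' \<in> el k \<Longrightarrow> Gp a d' \<Longrightarrow> d' = d"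
    using dk by blast+
  note t = theI'[OF ex1, folded G_def]
  show "G a \<in> el k" using t by blast
  show "Gp a d \<longleftrightarrow> d = G a" if "d \<in> el k" for d using t that ex1 by blast
qed

lemma el_k_trans: "E x y \<Longrightarrow> E y z \<Longrightarrow> z \<in> el k \<Longrightarrow> E x z"
proof -
  assume "E x y" "E y z" "z \<in> el k"
  moreover from this have "y \<in> el k" "x \<in> el k"
    using V.el_ordinal_subset[OF k_ord, of z] V.el_ordinal_subset[OF k_ord, of y] by (auto simp: elts_def)
  ultimately show ?thesis using V.wo_trans[OF wo_k] by blast
qed

text \<open>Nothing makes \<open>g\<close> increasing. Its strict suprema are weakly increasing,
  because a larger ordinal leaves more values to bound.\<close>

lemma G_mono:
  assumes a: "a \<in> el th" "h \<in> el th" "E a h" and x: "E x (G a)"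
  shows "E x (G h)"
proof -
  have ah: "el a \<subseteq> el h" using V.el_ordinal_subset[OF V.el_ordinal[OF th_ord a(2)], of a] a(3) by (simp add: elts_def)
  have "Gp a (G a)" "Gp h (G h)" using Gp_G[OF a(1) G_in[OF a(1)]] Gp_G[OF a(2) G_in[OF a(2)]] by auto
  then have "G a = G h \<or> E (G a) (G h)"
    unfolding Gp_iff[OF a(1)] Gp_iff[OF a(2)] using ah G_in[OF a(2)] by blast
  then show ?thesis using x el_k_trans[OF x _ G_in[OF a(2)]] by auto
qed

lemma G_cofinal:
  assumes "x \<in> el k"
  shows "\<exists>a\<in>el th. E x (G a)"
proof -
  obtain i where i: "i \<in> el th" "x = g i \<or> E x (g i)" using g assms by blast
  \<comment> \<open>Some \<open>a\<close> lies above \<open>i\<close>, as \<open>th\<close> is a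
    limit; then the strict supremum \<open>G a\<close> exceeds \<open>g i\<close>.\<close>
  obtain a where a: "a \<in> el th" "E i a" using V.regular_limit[OF th_reg i(1)] by blast
  have "Gp a (G a)" using Gp_G[OF a(1) G_in[OF a(1)]] by simp
  then have "E (g i) (G a)" using a(2) unfolding Gp_iff[OF a(1)] by (simp add: elts_def)
  then show ?thesis using i(2) el_k_trans[OF _ _ G_in[OF a(1)]] a(1) by blast
qed

subsection \<open>The covering matrix\<close>

definition K :: "'v \<Rightarrow> 'v \<Rightarrow> 'v set" where
  "K a b = {x \<in> el b. E (phi b x) (G a)}"

definition Kp :: "'v \<Rightarrow> 'v \<Rightarrow> 'v \<Rightarrow> bool" where
  "Kp a b x \<longleftrightarrow> x \<in> el b \<and> (\<exists>y\<in>el k. \<exists>d\<in>el k. Ph b x y \<and> Gp a d \<and> E y d)"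

lemma Kp_iff: "a \<in> el th \<Longrightarrow> b \<in> el l \<Longrightarrow> Kp a b x \<longleftrightarrow> x \<in> K a b"
  using Ph_iff[of b x] Gp_G[of a] phi_in[of b x] G_in[of a] by (auto simp: Kp_def K_def)

lemma dfn_Kp:
  assumes "V.tm t" "V.tm u" "V.tm v"
  shows "V.dfn (\<lambda>s. Kp (t s) (u s) (v s))"
  by (rule V.dfn_subst3[OF _ assms]) (unfold Kp_def, intro V_dfn dfn_Gp dfn_Ph)

lemma small_K:
  assumes "a \<in> el th" "b \<in> el l"
  shows "V.small (K a b)"
proof -
  have "V.small {x \<in> el b. Kp a b x}" by (intro V.small_sep small_el dfn_Kp V.tm_var V.tm_const UNIV_I)
  also have "{x \<in> el b. Kp a b x} = K a b" using Kp_iff[OF assms] by (auto simp: K_def)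
  finally show ?thesis .
qed

lemma K_subset: "K a b \<subseteq> el b"
  by (auto simp: K_def)

lemma K_mono: "a \<in> el th \<Longrightarrow> h \<in> el th \<Longrightarrow> E a h \<Longrightarrow> K a b \<subseteq> K h b"
  using G_mono by (auto simp: K_def)

lemma K_covers:
  assumes "b \<in> el l" "x \<in> el b"
  shows "\<exists>a\<in>el th. x \<in> K a b"
  using G_cofinal[OF phi_in[OF assms]] assms by (auto simp: K_def)

text \<open>\<open>phi b\<close> composed with the inverse of \<open>phi b'\<close> lies in \<open>W\<close>, where \<open>k\<close> is regular, so it
  maps the bounded set \<open>G a\<close> to a bounded set.\<close>

lemma K_coherent:
  assumes a: "a \<in> el th" and b: "b \<in> el l" and b': "b' \<in> el l"
  shows "\<exists>h\<in>el th. K a b' \<inter> el b \<subseteq> K h b"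
proof -
  have W: "b \<in> W" "b' \<in> W" "fc b \<in> W" "fc b' \<in> W" "G a \<in> W"
    using el_l_W[OF b] el_l_W[OF b'] fc b b' el_k_W[OF G_in[OF a]] by (auto simp: inj_code_def)
  note e = el_eq[OF W(1)] el_eq[OF W(2)] el_eq[OF k_W] el_eq[OF W(5)]
  \<comment> \<open>The values below \<open>G a\<close> that \<open>phi b'\<close> takes on
    \<open>b \<inter> b'\<close>, expressed through the code \<open>fc b'\<close> so that
    \<open>I\<close> is a set of \<open>W\<close>.\<close>
  define I where "I = {i \<in> el (G a). \<exists>x\<in>el b. x \<in> el b' \<and> maps_to W E (fc b') x i}"
  define B where "B i = phi b (inv_into (el b') (phi b') i)" for i
  have Gk: "i \<in> el k" if "i \<in> el (G a)" for i
    using that V.el_ordinal_subset[OF k_ord G_in[OF a]] by blast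
  have I_iff: "i \<in> I \<longleftrightarrow> i \<in> el (G a) \<and> (\<exists>x\<in>el b \<inter> el b'. i = phi b' x)" for i
    unfolding I_def maps_to_eq[OF W(4)] using mp_fc[OF b' _ Gk] by auto
  have B: "B (phi b' x) = phi b x" if "x \<in> el b'" for x
    using that by (simp add: B_def inv_into_f_f[OF phi_inj[OF b']])
  have sm: "N.small (el b)" "N.small (el b')" "N.small (el k)" "N.small (el (G a))"
    unfolding e[symmetric] using W k_W by (auto intro: N.small_el)
  have "N.small I"
    unfolding I_def by (intro N.small_sep N.dfn_basic N.dfn_maps_to N.cls_small sm W)
  then have "N.sfun I B"
  proof (rule N.sfunI[OF _ sm(3)])
    \<comment> \<open>Only two codes occur as parameters, and both lie in \<open>W\<close>; the
      whole family \<open>fc\<close> need not be available there.\<close>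
    show "N.dfn (\<lambda>s. \<exists>x\<in>el b. x \<in> el b' \<and> maps_to W E (fc b') x (s 0) \<and> maps_to W E (fc b) x (s 1))"
      by (intro N.dfn_basic N.dfn_maps_to N.cls_small sm W)
    show "B i \<in> el k" if "i \<in> I" for i using that B phi_in[OF b] by (auto simp: I_iff)
    fix i y assume i: "i \<in> I" and y: "y \<in> el k"
    then obtain x where x: "x \<in> el b" "x \<in> el b'" "i = phi b' x" "i \<in> el k" using Gk by (auto simp: I_iff)
    have "(\<exists>x\<in>el b. x \<in> el b' \<and> mp (fc b') x i \<and> mp (fc b) x y) \<longleftrightarrow>
        (\<exists>z\<in>el b. z \<in> el b' \<and> i = phi b' z \<and> y = phi b z)"
      using mp_fc[OF b' _ x(4)] mp_fc[OF b _ y] by blast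
    also have "\<dots> \<longleftrightarrow> y = B i" using x B inj_onD[OF phi_inj[OF b']] by metis
    finally show "(\<exists>x\<in>el b. x \<in> el b' \<and> maps_to W E (fc b') x i \<and> maps_to W E (fc b) x y) \<longleftrightarrow> y = B i"
      unfolding maps_to_eq[OF W(3)] maps_to_eq[OF W(4)] .
  qed
  note sB = this
  have m: "G a \<in> N.el k" "I \<subseteq> N.el (G a)" "B ` I \<subseteq> N.el k"
    unfolding e using G_in[OF a] B phi_in[OF b] by (auto simp: I_iff)
  obtain d where d: "d \<in> el k" "\<forall>i\<in>I. E (B i) d"
    using N.regular_bounded[OF k_reg_W m(1) sB m(2,3)] unfolding e by blast
  \<comment> \<open>Back in the universe, the bound found in \<open>W\<close> is overtaken by the
    cofinal sequence.\<close>
  obtain h where h: "h \<in> el th" "E d (G h)" using G_cofinal[OF d(1)] by blast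
  have "K a b' \<inter> el b \<subseteq> K h b"
  proof
    fix x assume x: "x \<in> K a b' \<inter> el b"
    then have xb: "x \<in> el b'" "x \<in> el b" "phi b' x \<in> el (G a)" by (auto simp: K_def elts_def)
    then have "phi b' x \<in> I" unfolding I_iff by blast
    then have "E (phi b x) d" using d(2) B[OF xb(1)] by metis
    then have "E (phi b x) (G h)" using el_k_trans[OF _ h(2) G_in[OF h(1)]] by blast
    then show "x \<in> K h b" using xb by (simp add: K_def)
  qed
  then show ?thesis using h(1) by blast
qed


subsection \<open>Sets of size at most \<open>k\<close> are bounded in \<open>l\<close>\<close>

text \<open>Otherwise \<open>l\<close> is the union of at most \<open>k\<close> many ordinals, each of them injected into \<open>k\<close>
  by \<open>phi\<close>, and the pairing function of \<open>W\<close> gives an injection of \<open>l\<close> into \<open>k\<close>. The tags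
  \<open>z0\<close> and \<open>z1\<close> separate the case \<open>x = c x\<close>, where \<open>phi\<close> is not available.\<close>

lemma bounded_if_inj:
  assumes A: "A \<subseteq> el l" and h: "V.sfun A h" "inj_on h A" "h ` A \<subseteq> el k"
  shows "\<exists>b\<in>el l. \<forall>a\<in>A. E a b"
proof (rule ccontr)
  assume n: "\<not> (\<exists>b\<in>el l. \<forall>a\<in>A. E a b)"
  note sA = V.sfun_small[OF h(1)]
  let ?S = "V.prods (el k) (el k)"
  have sS: "V.small ?S" by (intro V.small_prods small_el)
  \<comment> \<open>\<open>k\<close> is singular in the universe, so the pairing function is built
    in \<open>W\<close>, where \<open>k\<close> is regular, and carried up.\<close>
  obtain p where p: "V.sfun ?S p" "inj_on p ?S" "p ` ?S \<subseteq> el k"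
  proof -
    have "N.el k \<subseteq> W" using N.el_M by blast
    then have "N.prods (N.el k) (N.el k) = ?S" using prods_eq el_eq[OF k_W] by metis
    then show thesis
      using N.regular_pairing[OF k_reg_W] sfun_up that unfolding el_eq[OF k_W] by metis
  qed
  have opr_S: "V.opr u v \<in> ?S" if "u \<in> el k" "v \<in> el k" for u v
    using that by (auto simp: V.prods_def)
  define P where "P u v = p (V.opr u v)" for u v
  have P_in: "P u v \<in> el k" if "u \<in> el k" "v \<in> el k" for u v
    using p(3) opr_S[OF that] by (auto simp: P_def)
  have P_inj: "u = u' \<and> v = v'"
    if "P u v = P u' v'" "u \<in> el k" "v \<in> el k" "u' \<in> el k" "v' \<in> el k" for u v u' v'
    using inj_onD[OF p(2) that(1)[unfolded P_def] opr_S[OF that(2,3)] opr_S[OF that(4,5)]]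
    by (intro V.opr_inject) simp_all
  define PP where "PP u v w \<longleftrightarrow> (\<exists>q\<in>?S. is_opair UNIV E q u v \<and> (q, w) \<in> V.gr ?S p)" for u v w
  have PP_iff: "PP u v w \<longleftrightarrow> w = P u v" if "u \<in> el k" "v \<in> el k" for u v w
    using opr_S[OF that] V.is_opair_iff[OF UNIV_I] by (auto simp: PP_def P_def V.gr_iff)
  have dPP: "V.dfn (\<lambda>s. PP (t s) (u s) (v s))" if "V.tm t" "V.tm u" "V.tm v" for t u v
    by (rule V.dfn_subst3[OF _ that]) (unfold PP_def, intro V_dfn V.dfn_is_opair V.dfn_gr p sS)
  \<comment> \<open>The tags are \<open>th\<close>, in the part of \<open>z0\<close>, and some
    \<open>z1\<close> above it in \<open>k\<close>.\<close>
  obtain z1 where z1: "z1 \<in> el k" "E th z1"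
    using N.regular_limit[OF k_reg_W] th_in_k unfolding el_eq[OF k_W] by blast
  have z01: "th \<noteq> z1" using z1(2) V.wo_irrefl[OF wo_k th_in_k] by blast
  have "\<exists>a\<in>A. x = a \<or> E x a" if x: "x \<in> el l" for x
    using n x A V.wo_linear[OF wo_l x] by blast
  moreover have "V.dfn (\<lambda>s. s 0 = s 1 \<or> E (s 0) (s 1))" by (intro V_dfn)
  ultimately obtain c where c: "V.sfun (el l) c" "\<forall>x\<in>el l. c x \<in> A \<and> (x = c x \<or> E x (c x))"
    using V.choice_function[OF small_el[of l] sA, of "\<lambda>x a. x = a \<or> E x a"] by blast
  have cx: "c x \<in> A" "c x \<in> el l" "h (c x) \<in> el k" if "x \<in> el l" for x
    using that c(2) A h(3) by auto
  have below: "x \<in> el (c x)" if "x \<in> el l" "x \<noteq> c x" for x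
    using that c(2) by (auto simp: elts_def)
  define val where "val x = (if x = c x then P th th else P z1 (phi (c x) x))" for x
  have val_in: "val x \<in> el k" if x: "x \<in> el l" for x
    using P_in th_in_k z1(1) phi_in[OF cx(2)[OF x] below[OF x]] by (auto simp: val_def)
  \<comment> \<open>The first coordinate identifies the member \<open>c x\<close> of
    \<open>A\<close>, the second locates \<open>x\<close> at or below it.\<close>
  define F where "F x = P (h (c x)) (val x)" for x
  have F_in: "F x \<in> el k" if x: "x \<in> el l" for x
    unfolding F_def by (intro P_in cx val_in x)
  have "inj_on F (el l)"
  proof (rule inj_onI)
    fix x y assume x: "x \<in> el l" and y: "y \<in> el l" and xy: "F x = F y"
    from P_inj[OF xy[unfolded F_def] cx(3)[OF x] val_in[OF x] cx(3)[OF y] val_in[OF y]]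
    have e: "h (c x) = h (c y)" "val x = val y" by auto
    have cc: "c x = c y" by (rule inj_onD[OF h(2) e(1) cx(1)[OF x] cx(1)[OF y]])
    have not_tag: "P th th \<noteq> P z1 v" if "v \<in> el k" for v
      using P_inj[of th th z1 v] th_in_k z1(1) z01 that by blast
    show "x = y"
    proof (cases "x = c x")
      case True
      then have "y = c y"
        using e(2) not_tag phi_in[OF cx(2)[OF y] below[OF y]] unfolding val_def by metis
      then show ?thesis using True cc by simp
    next
      case False
      then have y': "y \<noteq> c y"
        using e(2) not_tag phi_in[OF cx(2)[OF x] below[OF x]] unfolding val_def by metis
      have "P z1 (phi (c x) x) = P z1 (phi (c y) y)" using e(2) False y' by (simp add: val_def)
      then have "phi (c x) x = phi (c x) y"
        using P_inj z1(1) phi_in[OF cx(2)[OF x] below[OF x False]] phi_in[OF cx(2)[OF y] below[OF y y']] cc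
        by metis
      then show ?thesis
        using inj_onD[OF phi_inj[OF cx(2)[OF x]]] below[OF x False] below[OF y y'] cc by metis
    qed
  qed
  moreover have "V.sfun (el l) F"
  proof (rule V.sfunI[OF small_el[of l] small_el[of k] F_in])
    define Q where "Q x w \<longleftrightarrow> (\<exists>a\<in>A. \<exists>u\<in>el k. \<exists>v\<in>el k. (x, a) \<in> V.gr (el l) c \<and> (a, u) \<in> V.gr A h \<and>
      PP u v w \<and> (x = a \<and> v = P th th \<or> x \<noteq> a \<and> (\<exists>y\<in>el k. Ph a x y \<and> PP z1 y v)))" for x w
    show "V.dfn (\<lambda>s. Q (s 0) (s 1))"
      unfolding Q_def by (intro V_dfn V.dfn_gr dPP dfn_Ph sA c(1) h(1))
    fix x w assume x: "x \<in> el l" and w: "w \<in> el k"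
    have "(x = c x \<and> v = P th th \<or> x \<noteq> c x \<and> (\<exists>y\<in>el k. Ph (c x) x y \<and> PP z1 y v)) \<longleftrightarrow> v = val x"
      if "v \<in> el k" for v
    proof (cases "x = c x")
      case False
      have "(\<exists>y\<in>el k. Ph (c x) x y \<and> PP z1 y v) \<longleftrightarrow> v = P z1 (phi (c x) x)"
        using Ph_iff[OF cx(2)[OF x] below[OF x False]] PP_iff[OF z1(1)] phi_in[OF cx(2)[OF x] below[OF x False]]
        by auto
      then show ?thesis using False by (simp add: val_def)
    qed (simp add: val_def)
    then have "Q x w \<longleftrightarrow> PP (h (c x)) (val x) w"
      unfolding Q_def V.gr_iff using x cx[OF x] val_in[OF x] by auto
    then show "Q x w \<longleftrightarrow> w = F x" using PP_iff[OF cx(3)[OF x] val_in[OF x]] by (simp add: F_def)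
  qed
  moreover have "F ` el l \<subseteq> el k" using F_in by blast
  ultimately show False using V.cardinal_no_inj[OF l_card k_l] by blast
qed

subsection \<open>The matrix as a set\<close>

lemma ex_matrix:
  "\<exists>D. is_matrix UNIV E D th l \<and> (\<forall>a\<in>el th. \<forall>b\<in>el l. el (entry UNIV E D a b) = K a b)"
proof -
  define T where "T = {z. el z \<subseteq> el l}"
  \<comment> \<open>The graph of the matrix. Each entry is described by its elements, since
    \<open>V.st (K a b)\<close> is not a term of the calculus.\<close>
  define r where "r = {(q, z). \<exists>a\<in>el th. \<exists>b\<in>el l. is_opair UNIV E q a b \<and> z \<in> T \<and>
    (\<forall>x\<in>el l. x \<in> el z \<longleftrightarrow> Kp a b x)}"
  have sT: "V.small T" using V.small_Pow[OF small_el[of l]] by (simp add: T_def)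
  have z_iff: "z \<in> T \<and> (\<forall>x\<in>el l. x \<in> el z \<longleftrightarrow> Kp a b x) \<longleftrightarrow> z = V.st (K a b)"
    if "a \<in> el th" "b \<in> el l" for a b z
  proof -
    have "K a b \<subseteq> el l" using K_subset el_l_trans[OF that(2)] by blast
    then have "z \<in> T \<and> (\<forall>x\<in>el l. x \<in> el z \<longleftrightarrow> Kp a b x) \<longleftrightarrow> el z = K a b"
      using Kp_iff[OF that] unfolding T_def by blast
    also have "\<dots> \<longleftrightarrow> z = V.st (K a b)"
      using V.st_el[OF UNIV_I, of z] V.el_st[OF small_K[OF that]] by auto
    finally show ?thesis .
  qed
  have r_iff: "(q, z) \<in> r \<longleftrightarrow> (\<exists>a\<in>el th. \<exists>b\<in>el l. is_opair UNIV E q a b \<and> z = V.st (K a b))" for q z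
    using z_iff unfolding r_def by blast
  have "V.smallrel r"
  proof (rule V.smallrelI)
    show "V.small (V.prods (el th) (el l))" by (intro V.small_prods small_el)
    show "V.small T" by (rule sT)
    show "r \<subseteq> V.prods (el th) (el l) \<times> T"
      unfolding r_def V.prods_def using V.is_opair_iff[OF UNIV_I] by auto
    show "V.dfn (\<lambda>s. (s 0, s 1) \<in> r)"
      unfolding r_def mem_Collect_eq case_prod_conv
      by (intro V_dfn V.dfn_is_opair dfn_Kp sT)
  qed
  then obtain D where D: "el D = (\<lambda>(x, y). V.opr x y) ` r" "\<And>q z. mp D q z \<longleftrightarrow> (q, z) \<in> r"
    using V.smallrel_code by blast
  have entry_iff: "is_entry UNIV E D a b z \<longleftrightarrow> z = V.st (K a b)" if "a \<in> el th" "b \<in> el l" for a b z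
  proof -
    have "is_entry UNIV E D a b z \<longleftrightarrow> (V.opr a b, z) \<in> r"
      unfolding is_entry_def D(2) using V.is_opair_iff[OF UNIV_I] by auto
    also have "\<dots> \<longleftrightarrow> z = V.st (K a b)"
    proof -
      have "is_opair UNIV E (V.opr a b) a' b' \<longleftrightarrow> a' = a \<and> b' = b" for a' b'
        using V.is_opair_iff[OF UNIV_I] V.opr_inject[OF UNIV_I UNIV_I UNIV_I UNIV_I] by blast
      then show ?thesis unfolding r_iff using that by auto
    qed
    finally show ?thesis .
  qed
  have "is_matrix UNIV E D th l"
    unfolding is_matrix_def
  proof (intro conjI ballI UNIV_I)
    fix p assume "p \<in> el D"
    then obtain q z where qz: "(q, z) \<in> r" "p = V.opr q z" unfolding D(1) by auto
    then obtain a b where "a \<in> el th" "b \<in> el l" "is_opair UNIV E q a b" unfolding r_def by blast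
    moreover have "is_opair UNIV E p q z" using qz(2) V.is_opair_iff[OF UNIV_I] by blast
    ultimately show "\<exists>\<alpha>\<in>el th. \<exists>\<beta>\<in>el l. \<exists>q\<in>UNIV. \<exists>k\<in>UNIV. is_opair UNIV E q \<alpha> \<beta> \<and> is_opair UNIV E p q k"
      by blast
  next
    fix a b assume "a \<in> el th" "b \<in> el l"
    then show "\<exists>!k. is_entry UNIV E D a b k" using entry_iff by simp
  qed
  moreover have "el (entry UNIV E D a b) = K a b" if "a \<in> el th" "b \<in> el l" for a b
    unfolding entry_def entry_iff[OF that] using V.el_st[OF small_K[OF that]] by simp
  ultimately show ?thesis by blast
qed

text \<open>\<open>K_coherent\<close> does not order its two columns. For \<open>c\<close> below
  \<open>b\<close> it gives the fourth condition. For the last one, \<open>X\<close> injects into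
  \<open>k\<close> and is therefore bounded by some \<open>b\<close>, and column \<open>b\<close>
  captures the trace on \<open>X\<close> of every other column.\<close>

lemma covering_matrix:
  assumes m: "is_matrix UNIV E D th l"
    and e: "\<And>a b. a \<in> el th \<Longrightarrow> b \<in> el l \<Longrightarrow> el (entry UNIV E D a b) = K a b"
  shows "is_covering_matrix UNIV E D th l"
  unfolding is_covering_matrix_def
proof (intro conjI ballI impI m)
  fix a b assume a: "a \<in> el th" and b: "b \<in> el l"
  show "el (entry UNIV E D a b) \<subseteq> el l"
    using e[OF a b] K_subset el_l_trans[OF b] by blast
  have "el (entry UNIV E D a b) \<subseteq> el b" using e[OF a b] K_subset by blast
  from V.cardinality_below[OF l_card b UNIV_I this]
  show "card_less UNIV E (entry UNIV E D a b) l" by (auto simp: card_less_def elts_def)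
  show "el (entry UNIV E D a b) \<subseteq> el (entry UNIV E D h b)" if "h \<in> el th" "E a h" for h
    unfolding e[OF a b] e[OF that(1) b] by (rule K_mono[OF a that])
next
  fix b assume b: "b \<in> el l"
  show "el b \<subseteq> (\<Union>a\<in>el th. el (entry UNIV E D a b))"
    using K_covers[OF b] e[OF _ b] by blast
next
  fix c b a assume "c \<in> el l" "b \<in> el l" "a \<in> el th" "E c b"
  moreover from this have "el c \<subseteq> el b"
    using V.el_ordinal_subset[OF V.el_ordinal[OF l_ord], of b c] by (simp add: elts_def)
  ultimately show "\<exists>h\<in>el th. el (entry UNIV E D a c) \<subseteq> el (entry UNIV E D h b)"
    using K_coherent[of a b c] K_subset[of a c] e by (metis Int_absorb2 subset_trans)
next
  fix X assume X: "el X \<subseteq> el l \<and> card_le UNIV E X th"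
  then obtain c F where c: "c = th \<or> E c th" and F: "V.sfun (el X) F" "bij_betw F (el X) (el c)"
    unfolding card_le_def is_card_of_def using V.bijection_iff[OF UNIV_I UNIV_I] by blast
  have "el c \<subseteq> el th" using c V.el_ordinal_subset[OF th_ord, of c] by (auto simp: elts_def)
  then have "el c \<subseteq> el k" using V.el_ordinal_subset[OF k_ord th_in_k] by blast
  then obtain b where b: "b \<in> el l" "\<forall>x\<in>el X. E x b"
    using bounded_if_inj[of "el X" F] X F by (auto simp: bij_betw_def)
  have Xb: "el X \<subseteq> el b" using b(2) by (auto simp: elts_def)
  have "\<exists>a\<in>el th. el (entry UNIV E D h b') \<inter> el X \<subseteq> el (entry UNIV E D a b)"
    if hb: "b' \<in> el l" "h \<in> el th" for b' h
  proof -
    obtain a where "a \<in> el th" "K h b' \<inter> el b \<subseteq> K a b" using K_coherent[OF hb(2) b(1) hb(1)] by blast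
    then show ?thesis using e hb b(1) Xb by blast
  qed
  then show "\<exists>c\<in>el l. \<forall>b\<in>el l. \<forall>h\<in>el th. \<exists>a\<in>el th.
      el (entry UNIV E D h b) \<inter> el X \<subseteq> el (entry UNIV E D a c)"
    using b(1) by blast
qed

subsection \<open>Unbounded sets are not covered\<close>

text \<open>An unbounded \<open>A\<close> does not inject into \<open>k\<close>, so \<open>k\<close>
  injects into the part of \<open>A\<close> below some point \<open>x\<close>. If a row
  \<open>K a x\<close> covered that part, \<open>phi x\<close> would carry \<open>k\<close>
  injectively into \<open>G a\<close>, although \<open>k\<close> is a cardinal.\<close>

lemma unbounded_not_covered:
  assumes A: "el A \<subseteq> el l" and unb: "\<forall>x\<in>el l. \<exists>a\<in>el A. E x a"
  shows "\<exists>b\<in>el l. \<forall>a\<in>el th. \<not> el A \<inter> el b \<subseteq> K a b"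
proof (rule ccontr)
  assume n: "\<not> ?thesis"
  have dE: "V.dfn (\<lambda>s. E (s 0) (s 1))" by (intro V_dfn)
  from V.wo_compare[OF small_el small_el V.wo_subset[OF wo_l A] wo_k dE dE] show False
  proof (elim disjE)
    assume "\<exists>H. V.sfun (el A) H \<and> inj_on H (el A) \<and> H ` el A \<subseteq> el k \<and>
      (\<forall>x\<in>el A. \<forall>y\<in>el k. E y (H x) \<longrightarrow> y \<in> H ` el A)"
    then obtain H where "V.sfun (el A) H" "inj_on H (el A)" "H ` el A \<subseteq> el k" by (elim exE conjE)
    from bounded_if_inj[OF A this] obtain b where b: "b \<in> el l" "\<forall>a\<in>el A. E a b" by (elim bexE)
    then obtain a where "a \<in> el A" "E b a" using unb by blast
    then show False using b A V.wo_asym[OF wo_l b(1), of a] by blast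
  next
    assume "\<exists>x\<in>el A. \<exists>H. V.sfun (el k) H \<and> inj_on H (el k) \<and> H ` el k \<subseteq> {y \<in> el A. E y x}"
    then obtain x H where x: "x \<in> el A" and H: "V.sfun (el k) H" "inj_on H (el k)"
      "H ` el k \<subseteq> {y \<in> el A. E y x}" by blast
    have xl: "x \<in> el l" using x A by blast
    then obtain a where a: "a \<in> el th" "el A \<inter> el x \<subseteq> K a x" using n by blast
    have HK: "H ` el k \<subseteq> K a x" using H(3) a(2) by (auto simp: elts_def)
    then have Hx: "H ` el k \<subseteq> el x" using K_subset by blast
    have "V.sfun (el k) (\<lambda>i. phi x (H i))" by (rule V.sfun_comp[OF H(1) sfun_phi[OF xl] Hx])
    moreover have "inj_on (\<lambda>i. phi x (H i)) (el k)"
      using comp_inj_on[OF H(2) inj_on_subset[OF phi_inj[OF xl] Hx]] by (simp add: o_def)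
    moreover have "(\<lambda>i. phi x (H i)) ` el k \<subseteq> el (G a)"
      using HK by (auto simp: K_def elts_def)
    ultimately show False using V.cardinal_no_inj[OF k_card G_in[OF a(1)]] by blast
  qed
qed

text \<open>\<open>X\<close> picks the least element of each rank, where the rank of \<open>x\<close> is the least row of column \<open>b\<close>
  containing it. The ranks are unbounded in the regular cardinal \<open>th\<close>, so \<open>X\<close> has size \<open>th\<close>.\<close>

lemma ex_uncovered_subset:
  assumes b: "b \<in> el l" and nb: "\<forall>a\<in>el th. \<not> el A \<inter> el b \<subseteq> K a b"
  shows "\<exists>X. el X \<subseteq> el A \<inter> el b \<and> is_card_of UNIV E X th \<and> (\<forall>a\<in>el th. \<not> el X \<subseteq> K a b)"
proof -
  define B where "B = el A \<inter> el b"
  have sB: "V.small B" unfolding B_def by (intro V.small_Int small_el)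
  define rp where "rp x a \<longleftrightarrow> Kp a b x \<and> (\<forall>a'\<in>el th. Kp a' b x \<longrightarrow> a = a' \<or> E a a')" for x a
  have drp: "V.dfn (\<lambda>s. rp (t s) (u s))" if "V.tm t" "V.tm u" for t u
    by (rule V.dfn_subst2[OF _ that]) (unfold rp_def, intro V_dfn dfn_Kp)
  have rp_iff: "rp x a \<longleftrightarrow> x \<in> K a b \<and> (\<forall>a'\<in>el th. x \<in> K a' b \<longrightarrow> a = a' \<or> E a a')" if "a \<in> el th" for x a
    using Kp_iff[OF _ b] that by (simp add: rp_def)
  define rk where "rk x = (THE a. a \<in> el th \<and> rp x a)" for x
  have ex1: "\<exists>!a. a \<in> el th \<and> rp x a" if x: "x \<in> B" for x
  proof -
    let ?Z = "{a \<in> el th. Kp a b x}"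
    have Z: "V.small ?Z" "?Z \<subseteq> el th" by (intro V.small_sep small_el dfn_Kp V.tm_var V.tm_const UNIV_I) blast
    have "?Z \<noteq> {}" using K_covers[OF b, of x] Kp_iff[OF _ b] x by (auto simp: B_def)
    from V.wo_least[OF wo_th Z this] obtain a where a: "a \<in> ?Z" "\<forall>z\<in>?Z. a = z \<or> E a z" by (elim bexE)
    show ?thesis
    proof (rule ex1I[of _ a])
      show "a \<in> el th \<and> rp x a" using a by (auto simp: rp_def)
      fix a' assume a': "a' \<in> el th \<and> rp x a'"
      then have "a = a' \<or> E a a'" "a' = a \<or> E a' a" using a by (auto simp: rp_def)
      then show "a' = a" using V.wo_asym[OF wo_th, of a a'] a a' by blast
    qed
  qed
  have rk: "rk x \<in> el th \<and> rp x (rk x)" if "x \<in> B" for x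
    unfolding rk_def by (rule theI'[OF ex1[OF that]])
  have rk_eq: "rp x a \<longleftrightarrow> a = rk x" if "x \<in> B" "a \<in> el th" for x a
    using rk[OF that(1)] ex1[OF that(1)] that(2) by metis
  have srk: "V.sfun B rk"
  proof (rule V.sfunI[OF sB small_el[of th]])
    show "V.dfn (\<lambda>s. rp (s 0) (s 1))" by (intro drp V.tm_var)
  qed (use rk rk_eq in auto)
  have rk_least: "rk x = a \<or> E (rk x) a" if "x \<in> B" "a \<in> el th" "x \<in> K a b" for x a
    using rk[OF that(1)] rp_iff that by blast
  have rk_K: "x \<in> K (rk x) b" if "x \<in> B" for x
    using rk[OF that] rp_iff by blast
  define R where "R = rk ` B"
  have sR: "V.small R" unfolding R_def by (rule V.sfun_image[OF srk])
  have Rth: "R \<subseteq> el th" using rk by (auto simp: R_def)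
  \<comment> \<open>A point outside \<open>K a b\<close> has rank above \<open>a\<close>, because
    the rows of a column increase.\<close>
  have R_unb: "\<exists>c\<in>R. E a c" if a: "a \<in> el th" for a
  proof -
    obtain x where x: "x \<in> B" "x \<notin> K a b" using nb a by (auto simp: B_def)
    have "rk x \<noteq> a" "\<not> E (rk x) a"
      using rk_K[OF x(1)] x(2) K_mono[OF _ a, of "rk x"] rk[OF x(1)] by auto
    then have "E a (rk x)" using V.wo_linear[OF wo_th a, of "rk x"] rk[OF x(1)] by blast
    then show ?thesis using x(1) by (auto simp: R_def)
  qed
  have dE: "V.dfn (\<lambda>s. E (s 0) (s 1))" by (intro V_dfn)
  have "\<exists>H. V.sfun (el th) H \<and> inj_on H (el th) \<and> H ` el th \<subseteq> R"
    using V.wo_compare[OF small_el sR wo_th V.wo_subset[OF wo_th Rth] dE dE]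
  proof (elim disjE)
    assume "\<exists>x\<in>el th. \<exists>H. V.sfun R H \<and> inj_on H R \<and> H ` R \<subseteq> {y \<in> el th. E y x}"
    \<comment> \<open>If \<open>R\<close> embedded below some \<open>x\<close> in \<open>th\<close>,
      the inverse map would have a bounded domain and an unbounded range in \<open>th\<close>,
      against regularity.\<close>
    then obtain x H where x: "x \<in> el th" and H: "V.sfun R H" "inj_on H R"
      "H ` R \<subseteq> {y \<in> el th. E y x}" by blast
    have "H ` R \<subseteq> el x" using H(3) by (auto simp: elts_def)
    moreover have "inv_into R H ` H ` R \<subseteq> el th" using Rth H(2) by simp
    ultimately obtain d where d: "d \<in> el th" "\<forall>i\<in>H ` R. E (inv_into R H i) d"
      using V.regular_bounded[OF th_reg x V.sfun_inv[OF H(1,2)]] by blast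
    obtain c where c: "c \<in> R" "E d c" using R_unb[OF d(1)] by blast
    have "E c d" using d(2) c(1) H(2) by auto
    moreover have "c \<in> el th" using c(1) Rth by blast
    ultimately have False using V.wo_asym[OF wo_th d(1), of c] c(2) by simp
    then show ?thesis ..
  next
    assume "\<exists>H. V.sfun (el th) H \<and> inj_on H (el th) \<and> H ` el th \<subseteq> R \<and>
      (\<forall>x\<in>el th. \<forall>y\<in>R. E y (H x) \<longrightarrow> y \<in> H ` el th)"
    then show ?thesis by (elim exE conjE) (intro exI conjI)
  qed
  then obtain H0 where H0: "V.sfun (el th) H0" "inj_on H0 (el th)" "H0 ` el th \<subseteq> R" by (elim exE conjE)
  from V.bij_of_inj_into_subset[OF H0 Rth sR]
  obtain H where H: "V.sfun (el th) H" "bij_betw H (el th) R" by (elim exE conjE)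
  \<comment> \<open>The inner existential says that \<open>x\<close> and \<open>y\<close> have equal
    rank. Least elements select one point of each rank definably.\<close>
  define XX where "XX = {x \<in> B. \<forall>y\<in>B. (\<exists>a\<in>el th. rp x a \<and> rp y a) \<longrightarrow> x = y \<or> E x y}"
  have sX: "V.small XX" unfolding XX_def by (intro V.small_sep sB V_dfn drp)
  have same: "(\<exists>a\<in>el th. rp x a \<and> rp y a) \<longleftrightarrow> rk x = rk y" if "x \<in> B" "y \<in> B" for x y
    using rk_eq that rk by metis
  have XB: "XX \<subseteq> B" by (auto simp: XX_def)
  have wo_B: "V.wo B E" by (rule V.wo_subset[OF wo_l]) (use el_l_trans[OF b] in \<open>auto simp: B_def\<close>)
  have injX: "inj_on rk XX"
  proof (rule inj_onI)
    fix x y assume xy: "x \<in> XX" "y \<in> XX" "rk x = rk y"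
    then have m: "x \<in> B" "y \<in> B" using XB by auto
    have "x = y \<or> E x y" "y = x \<or> E y x" using xy m same by (auto simp: XX_def)
    then show "x = y" using V.wo_asym[OF wo_B m] by blast
  qed
  have imgX: "rk ` XX = R"
  proof
    show "rk ` XX \<subseteq> R" using XB by (auto simp: R_def)
    show "R \<subseteq> rk ` XX"
    proof
      fix c assume c: "c \<in> R"
      let ?Z = "{x \<in> B. rp x c}"
      have cth: "c \<in> el th" using c Rth by blast
      have Z: "V.small ?Z" "?Z \<subseteq> B" by (intro V.small_sep sB drp V.tm_var V.tm_const UNIV_I) blast
      have "?Z \<noteq> {}" using c rk by (auto simp: R_def)
      from V.wo_least[OF wo_B Z this] obtain x where x: "x \<in> ?Z" "\<forall>z\<in>?Z. x = z \<or> E x z" by (elim bexE)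
      have rx: "rk x = c" using x(1) rk_eq cth by blast
      have "x \<in> XX" unfolding XX_def using x rk_eq same cth rx by auto
      then show "c \<in> rk ` XX" using rx by blast
    qed
  qed
  have "V.sfun XX rk" by (rule V.sfun_subset[OF srk sX XB])
  moreover have Hinv: "V.sfun R (inv_into (el th) H)"
    using V.sfun_inv[OF H(1)] H(2) by (auto simp: bij_betw_def)
  ultimately have "V.sfun XX (\<lambda>x. inv_into (el th) H (rk x))" by (rule V.sfun_comp) (simp add: imgX)
  moreover have "bij_betw (\<lambda>x. inv_into (el th) H (rk x)) XX (el th)"
    using bij_betw_trans[OF _ bij_betw_inv_into[OF H(2)], of rk XX] injX imgX
    by (simp add: bij_betw_def o_def)
  moreover have "el (V.st XX) = XX" by (rule V.el_st[OF sX])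
  ultimately have "\<exists>f\<in>UNIV. is_bijection UNIV E f (V.st XX) th"
    using V.bijection_iff[OF UNIV_I UNIV_I, of "V.st XX" th] by metis
  then have "is_card_of UNIV E (V.st XX) th"
    using th_reg by (auto simp: is_card_of_def is_regular_cardinal_def is_infinite_cardinal_def)
  moreover have "\<not> XX \<subseteq> K a b" if a: "a \<in> el th" for a
  proof
    assume *: "XX \<subseteq> K a b"
    \<comment> \<open>Containment in row \<open>a\<close> would bound all ranks by
      \<open>a\<close>.\<close>
    obtain c where c: "c \<in> R" "E a c" using R_unb[OF a] by blast
    then obtain x where x: "x \<in> XX" "c = rk x" using imgX by blast
    then have "x \<in> B" "x \<in> K a b" using XB * by auto
    then have "c = a \<or> E c a" using rk_least[OF _ a] x(2) by blast
    then show False using c Rth V.wo_irrefl[OF wo_th a] V.wo_asym[OF wo_th a, of c] by blast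
  qed
  ultimately show ?thesis using XB \<open>el (V.st XX) = XX\<close> unfolding B_def by metis
qed

section \<open>Contradiction with the covering property\<close>

text \<open>The covering property may place \<open>X\<close> in any column; coherence moves the
  cover to column \<open>b\<close>, where \<open>X\<close> escapes every row.\<close>

lemma not_CP: "\<not> CP UNIV E l th"
proof
  assume CP: "CP UNIV E l th"
  obtain D where D: "is_matrix UNIV E D th l"
    "\<And>a b. a \<in> el th \<Longrightarrow> b \<in> el l \<Longrightarrow> el (entry UNIV E D a b) = K a b"
    using ex_matrix by blast
  have "is_covering_matrix UNIV E D th l" by (rule covering_matrix[OF D])
  from mp[OF bspec[OF CP[unfolded CP_def] UNIV_I] this]
  obtain A where A: "el A \<subseteq> el l" "\<forall>x\<in>el l. \<exists>a\<in>el A. E x a"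
    "\<forall>X\<in>UNIV. el X \<subseteq> el A \<and> is_card_of UNIV E X th \<longrightarrow>
       (\<exists>a\<in>el th. \<exists>b\<in>el l. el X \<subseteq> el (entry UNIV E D a b))"
    by (elim bexE conjE)
  obtain b where b: "b \<in> el l" "\<forall>a\<in>el th. \<not> el A \<inter> el b \<subseteq> K a b"
    using unbounded_not_covered[OF A(1,2)] by blast
  obtain X where X: "el X \<subseteq> el A \<inter> el b" "is_card_of UNIV E X th" "\<forall>a\<in>el th. \<not> el X \<subseteq> K a b"
    using ex_uncovered_subset[OF b] by blast
  obtain a' b' where a': "a' \<in> el th" "b' \<in> el l" "el X \<subseteq> K a' b'"
  proof -
    have "\<exists>a\<in>el th. \<exists>b\<in>el l. el X \<subseteq> el (entry UNIV E D a b)"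
      using A(3) X(1,2) by simp
    then show thesis using D(2) that by blast
  qed
  obtain a where "a \<in> el th" "K a' b' \<inter> el b \<subseteq> K a b" using K_coherent[OF a'(1) b(1) a'(2)] by blast
  then show False using X(1,3) a'(3) by blast
qed

end

theorem mainTheorem6:
  fixes E :: "'v \<Rightarrow> 'v \<Rightarrow> bool"
    and W :: "'v set"
    and \<kappa> \<kappa>_plus \<theta> :: 'v
  assumes "ZFC_model UNIV E"
    and "is_cardinal UNIV E \<kappa>"
    and "is_regular_cardinal UNIV E \<theta>"
    and "E \<theta> \<kappa>"
    and "is_succ_cardinal UNIV E \<kappa> \<kappa>_plus"
    and "CP UNIV E \<kappa>_plus \<theta>"
    and "inner_model E W"
    and "is_regular_cardinal W E \<kappa>"
    and "is_succ_cardinal W E \<kappa> \<kappa>_plus"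
  shows "\<not> is_cof UNIV E \<kappa> \<theta>"
proof
  assume "is_cof UNIV E \<kappa> \<theta>"
  moreover have "zfc UNIV E" by (rule zfc.intro[OF assms(1)])
  moreover have "zfc W E" using assms(7) by (simp add: inner_model_def zfc.intro)
  moreover have "zfc.cls UNIV E W"
    using assms(7) zfc_definable_class[OF \<open>zfc UNIV E\<close>] by (simp add: inner_model_def)
  moreover have "y \<in> W" if "x \<in> W" "E y x" for x y
    using assms(7) that by (auto simp: inner_model_def)
  ultimately have "singularized_cardinal E W \<kappa> \<kappa>_plus \<theta>"
    using assms(2-5,8,9)
    by (auto simp: singularized_cardinal_def singularized_cardinal_axioms_def
        transitive_inner_def transitive_inner_axioms_def)
  from singularized_cardinal.not_CP[OF this] show False using assms(6) by blast
qed

end
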